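(* For a nonnegative integer $n$, let $p_{9,3}(n)$ be defined by $\sum_{n\geq0}p_{9,3}(n)q^n=\frac{1}{(q;q)_\infty^3(q^9;q^9)_\infty^3}$. Then for all integers $n\geq0$ and $\alpha\geq1$, \begin{align*} p_{9,3}\left(3^{2\alpha-1}n+\tfrac{3^{2\alpha-1}+5}{4}\right) &\equiv0\pmod{3^{2\alpha}},\\ p_{9,3}\left(3^{2\alpha+1}n+\tfrac{7\cdot3^{2\alpha}+5}{4}\right) &\equiv0\pmod{3^{2\alpha+4}},\\ p_{9,3}\left(3^{2\alpha+1}n+\tfrac{11\cdot3^{2\alpha}+5}{4}\right) &\equiv0\pmod{3^{2\alpha+5}},\\ p_{9,3}\left(3^{2\alpha}n+\tfrac{5\cdot3^{2\alpha-1}+5}{4}\right) &\equiv0\pmod{3^{2\alpha+1}},\\ p_{9,3}\left(3^{2\alpha}n+\tfrac{3^{2\alpha+1}+5}{4}\right) &\equiv0\pmod{3^{2\alpha+2}}. \end{align*}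
   Context: $(a;q)_\infty=\prod_{n\ge0}(1-aq^n)$. $p_{9,3}(n)$ counts 2-color partition triples of $n$ where one of the colors appears only in parts that are multiples of $9$. *)

theory Defs
  imports
    "HOL-Analysis.Infinite_Products"
    "HOL-Computational_Algebra.Formal_Power_Series"
    "HOL-Number_Theory.Cong"
begin

definition qpoch_inf :: "'a \<Rightarrow> 'a \<Rightarrow> 'a::{t2_space, comm_ring_1}"
  where "qpoch_inf a q = (\<Prod>n. 1 - a * q ^ n)"

text \<open>
  For formal power series the infinite product is taken in the library's topology, in which
  convergence means that every coefficient is eventually constant. The following lemma
  shows that it does converge for the arguments used below.
\<close>

lemma qpoch_inf_fps_has_prod:
  fixes a q :: "'a::idom fps"
  assumes a: "fps_nth a 0 = 0" and q: "fps_nth q 0 = 0"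
  shows "(\<lambda>n. 1 - a * q ^ n) has_prod qpoch_inf a q"
    and "fps_nth (qpoch_inf a q) 0 = 1"
proof -
  define P where "P n = (\<Prod>i\<le>n. 1 - a * q ^ i)" for n
  define L where "L = Abs_fps (\<lambda>k. fps_nth (P k) k)"
  have coeff: "fps_nth (P n * (a * q ^ Suc n)) k = 0" if "k \<le> n" for n k
  proof -
    have "fps_nth (q ^ Suc n) i = 0" if "i \<le> n" for i
      using startsby_zero_power_prefix[OF q, of "Suc n"] that by (metis le_imp_less_Suc)
    then have "fps_nth (P n * a * q ^ Suc n) k = 0"
      using that unfolding fps_mult_nth by (intro sum.neutral) simp
    then show ?thesis
      by (simp only: mult.assoc)
  qed
  have stable: "fps_nth (P n) k = fps_nth L k" if "k \<le> n" for n k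
    using that
  proof (induction n rule: dec_induct)
    case base
    then show ?case by (simp add: L_def)
  next
    case (step n)
    have "P (Suc n) = P n - P n * (a * q ^ Suc n)"
      by (simp add: P_def algebra_simps)
    then show ?case
      using step coeff by simp
  qed
  have "P \<longlonglongrightarrow> L"
  proof (rule tendsto_fpsI)
    fix k
    show "\<forall>\<^sub>F n in sequentially. fps_nth (P n) k = fps_nth L k"
      using stable by (intro eventually_sequentiallyI[of k]) auto
  qed
  moreover have L0: "fps_nth L 0 = 1"
    by (simp add: L_def P_def a)
  then have "L \<noteq> 0"
    by auto
  ultimately have *: "(\<lambda>n. 1 - a * q ^ n) has_prod L"
    by (simp add: has_prod_def raw_has_prod_def P_def[abs_def])
  have "qpoch_inf a q = L"
    unfolding qpoch_inf_def using has_prod_unique[OF *] by simp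
  with * L0 show "(\<lambda>n. 1 - a * q ^ n) has_prod qpoch_inf a q"
    and "fps_nth (qpoch_inf a q) 0 = 1"
    by simp_all
qed

text \<open>
  The denominator has constant term \<open>1\<close>, so it is invertible over \<open>int\<close>; \<open>/\<close> is not
  available for series over \<open>int\<close>, hence \<^term>\<open>fps_right_inverse\<close>, whose second argument is the
  inverse of the constant term.
\<close>

definition p93_denominator :: "int fps"
  where "p93_denominator = qpoch_inf fps_X fps_X ^ 3 * qpoch_inf (fps_X ^ 9) (fps_X ^ 9) ^ 3"

definition p93 :: "nat \<Rightarrow> int"
  where "p93 n = fps_nth (fps_right_inverse p93_denominator 1) n"

lemma p93_generating_function:
  "p93_denominator * Abs_fps p93 = 1"
proof -
  have "fps_nth p93_denominator 0 = 1"
    by (simp add: p93_denominator_def qpoch_inf_fps_has_prod fps_nth_power_0)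
  then have "p93_denominator * fps_right_inverse p93_denominator 1 = 1"
    by (intro fps_right_inverse) simp
  moreover have "Abs_fps p93 = fps_right_inverse p93_denominator 1"
    by (rule fps_ext) (simp add: p93_def)
  ultimately show ?thesis
    by simp
qed

lemma p93_unique:
  assumes "p93_denominator * Abs_fps p = 1"
  shows "p = p93"
proof -
  have "Abs_fps p = (p93_denominator * Abs_fps p93) * Abs_fps p"
    by (simp only: p93_generating_function mult_1_left)
  also have "\<dots> = Abs_fps p93 * (p93_denominator * Abs_fps p)"
    by (simp only: mult_ac)
  also have "\<dots> = Abs_fps p93"
    by (simp only: assms mult_1_right)
  finally have "fps_nth (Abs_fps p) n = fps_nth (Abs_fps p93) n" for n
    by (rule arg_cong)
  then show ?thesis
    by (intro ext) simp
qed

text \<open>The quotients by \<open>4\<close> in the arguments of \<^const>\<open>p93\<close> are exact.\<close>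

lemma four_dvd_arguments:
  fixes \<alpha> :: nat
  assumes "\<alpha> \<ge> 1"
  shows "4 dvd (3 ^ (2 * \<alpha> - 1) + 5 :: nat)"
    and "4 dvd (7 * 3 ^ (2 * \<alpha>) + 5 :: nat)"
    and "4 dvd (11 * 3 ^ (2 * \<alpha>) + 5 :: nat)"
    and "4 dvd (5 * 3 ^ (2 * \<alpha> - 1) + 5 :: nat)"
    and "4 dvd (3 ^ (2 * \<alpha> + 1) + 5 :: nat)"
proof -
  have even: "\<exists>m. (3 ^ (2 * k) :: nat) = 4 * m + 1" for k
  proof (induction k)
    case 0
    show ?case by simp
  next
    case (Suc k)
    then obtain m where "(3 ^ (2 * k) :: nat) = 4 * m + 1" ..
    then have "(3 ^ (2 * Suc k) :: nat) = 4 * (9 * m + 2) + 1" by simp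
    then show ?case ..
  qed
  obtain k where k: "2 * \<alpha> - 1 = Suc (2 * k)"
    using assms by (cases \<alpha>) auto
  obtain m where m: "(3 ^ (2 * k) :: nat) = 4 * m + 1"
    using even by blast
  obtain l where l: "(3 ^ (2 * \<alpha>) :: nat) = 4 * l + 1"
    using even by blast
  have "(3 ^ (2 * \<alpha> - 1) + 5 :: nat) = 4 * (3 * m + 2)"
    "(5 * 3 ^ (2 * \<alpha> - 1) + 5 :: nat) = 4 * (15 * m + 5)"
    unfolding k power_Suc m by simp_all
  then show "4 dvd (3 ^ (2 * \<alpha> - 1) + 5 :: nat)" "4 dvd (5 * 3 ^ (2 * \<alpha> - 1) + 5 :: nat)"
    by (simp_all only: dvd_triv_left)
  have "(7 * 3 ^ (2 * \<alpha>) + 5 :: nat) = 4 * (7 * l + 3)"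
    "(11 * 3 ^ (2 * \<alpha>) + 5 :: nat) = 4 * (11 * l + 4)"
    "(3 ^ (2 * \<alpha> + 1) + 5 :: nat) = 4 * (3 * l + 2)"
    unfolding Suc_eq_plus1[symmetric] power_Suc l by simp_all
  then show "4 dvd (7 * 3 ^ (2 * \<alpha>) + 5 :: nat)" "4 dvd (11 * 3 ^ (2 * \<alpha>) + 5 :: nat)"
    "4 dvd (3 ^ (2 * \<alpha> + 1) + 5 :: nat)"
    by (simp_all only: dvd_triv_left)
qed

end

theory Submission
  imports Defs "HOL-Library.Nat_Bijection"
begin

text \<open>
  Write \<open>E(q) = (q;q)\<^sub>\<infinity>\<close>. By Jacobi's identity \<open>E(q)\<^sup>3 = A - 3 q E(q\<^sup>9)\<^sup>3\<close> with \<open>A\<close> a series in \<open>q\<^sup>3\<close>,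
  and multiplying the three conjugates under \<open>q \<mapsto> \<omega> q\<close> gives
  \<open>A\<^sup>3 - 27 q\<^sup>3 E(q\<^sup>9)\<^sup>9 = (E(q\<^sup>3)\<^sup>4 / E(q\<^sup>9))\<^sup>3\<close>. Hence \<open>1 / E(q)\<^sup>3\<close> is a quadratic form in \<open>A\<close> and
  \<open>3 q E(q\<^sup>9)\<^sup>3\<close>, up to a factor in \<open>q\<^sup>3\<close>. Put \<open>T = 27 q E(q\<^sup>3)\<^sup>1\<^sup>2 / E(q)\<^sup>1\<^sup>2\<close>. Since each \<open>q\<close> in that form
  carries a factor \<open>3\<close>, and \<open>A\<^sup>3\<close> becomes \<open>E(q)\<^sup>1\<^sup>2 (1 + T) / E(q\<^sup>3)\<^sup>3\<close>, extracting an arithmetic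
  progression modulo \<open>3\<close> maps \<open>E(q\<^sup>3)\<^sup>6 / E(q)\<^sup>1\<^sup>2 \<int>[T]\<close> into \<open>9 E(q\<^sup>3)\<^sup>1\<^sup>2 / E(q)\<^sup>1\<^sup>8 \<int>[T]\<close> (residue 2)
  and the latter module without the \<open>9\<close> back into the former (residue 0). Starting from
  \<open>\<Sum> p(3n+2) q\<^sup>n = 9 E(q\<^sup>3)\<^sup>6 / E(q)\<^sup>1\<^sup>2\<close>, two powers of \<open>3\<close> are gained in every other step; the
  remaining residues gain the extra powers of \<open>3\<close>, where the coefficients \<open>6\<close> and \<open>21\<close> of
  \<open>(1 + x + x\<^sup>2)\<^sup>6\<close> contribute one factor \<open>3\<close> each.
\<close>

section \<open>Continuity of the operations on formal power series\<close>

lemma tendsto_fps_add: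
  fixes f g :: "'b \<Rightarrow> 'a::group_add fps"
  assumes "(f \<longlongrightarrow> a) F" "(g \<longlongrightarrow> b) F"
  shows "((\<lambda>x. f x + g x) \<longlongrightarrow> a + b) F"
  unfolding tendsto_fps_iff
proof
  fix n
  show "\<forall>\<^sub>F x in F. fps_nth (f x + g x) n = fps_nth (a + b) n"
    using assms[unfolded tendsto_fps_iff, THEN spec[of _ n]] by eventually_elim simp
qed

text \<open>Each coefficient of a product involves finitely many coefficients of the factors, and
  finitely many eventual equalities eventually hold simultaneously.\<close>

lemma tendsto_fps_mult:
  fixes f g :: "'b \<Rightarrow> 'a::ring fps"
  assumes "(f \<longlongrightarrow> a) F" "(g \<longlongrightarrow> b) F"
  shows "((\<lambda>x. f x * g x) \<longlongrightarrow> a * b) F"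
  unfolding tendsto_fps_iff
proof
  fix n
  have *: "\<forall>\<^sub>F x in F. \<forall>i\<in>{0..n}. fps_nth (h x) i = fps_nth c i"
    if "(h \<longlongrightarrow> c) F" for h :: "'b \<Rightarrow> 'a fps" and c
    using that unfolding tendsto_fps_iff by (simp add: eventually_ball_finite)
  show "\<forall>\<^sub>F x in F. fps_nth (f x * g x) n = fps_nth (a * b) n"
    using *[OF assms(1)] *[OF assms(2)]
    by eventually_elim (auto simp: fps_mult_nth intro!: sum.cong)
qed

lemma tendsto_fps_power:
  fixes f :: "'b \<Rightarrow> 'a::ring_1 fps"
  assumes "(f \<longlongrightarrow> a) F"
  shows "((\<lambda>x. f x ^ n) \<longlongrightarrow> a ^ n) F"
  by (induction n) (auto intro: tendsto_fps_mult assms)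

lemma tendsto_fps_compose:
  fixes f :: "'b \<Rightarrow> 'a::ring_1 fps"
  assumes "(f \<longlongrightarrow> a) F"
  shows "((\<lambda>x. f x oo c) \<longlongrightarrow> a oo c) F"
  unfolding tendsto_fps_iff
proof
  fix n
  have "\<forall>\<^sub>F x in F. \<forall>i\<in>{0..n}. fps_nth (f x) i = fps_nth a i"
    using assms unfolding tendsto_fps_iff by (simp add: eventually_ball_finite)
  then show "\<forall>\<^sub>F x in F. fps_nth (f x oo c) n = fps_nth (a oo c) n"
    by eventually_elim (auto simp: fps_compose_nth intro!: sum.cong)
qed

section \<open>Trisection of power series\<close>

definition trisect :: "nat \<Rightarrow> 'a fps \<Rightarrow> 'a fps"
  where "trisect r f = Abs_fps (\<lambda>n. fps_nth f (3 * n + r))"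

lemma trisect_nth [simp]: "fps_nth (trisect r f) n = fps_nth f (3 * n + r)"
  by (simp add: trisect_def)

lemma trisect_add: "trisect r (f + g) = trisect r f + trisect r g"
  by (rule fps_ext) simp

lemma trisect_diff: "trisect r (f - g) = trisect r f - trisect r g"
  by (rule fps_ext) simp

lemma trisect_0 [simp]: "trisect r 0 = 0"
  by (rule fps_ext) simp

lemma trisect_sum: "trisect r (\<Sum>i\<in>A. f i) = (\<Sum>i\<in>A. trisect r (f i))"
  by (rule fps_ext) (simp add: fps_sum_nth)

lemma trisect_const_mult: "trisect r (fps_const c * f) = fps_const c * trisect r f"
  for c :: "'a::semiring_0"
  by (rule fps_ext) simp

lemma tendsto_trisect:
  assumes "(f \<longlongrightarrow> a) F"
  shows "((\<lambda>x. trisect r (f x)) \<longlongrightarrow> trisect r a) F"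
  using assms unfolding tendsto_fps_iff by simp

abbreviation triple :: "'a::comm_ring_1 fps \<Rightarrow> 'a fps"
  where "triple f \<equiv> f oo fps_X ^ 3"

lemma triple_nth: "fps_nth (triple f) n = (if 3 dvd n then fps_nth f (n div 3) else 0)"
proof -
  have "fps_nth (triple f) n = (\<Sum>i=0..n. if i * 3 = n then fps_nth f i else 0)"
    unfolding fps_compose_nth by (intro sum.cong) (auto simp: mult.commute simp flip: power_mult)
  also have "\<dots> = (if 3 dvd n then fps_nth f (n div 3) else 0)"
  proof (cases "3 dvd n")
    case True
    then obtain k where "n = 3 * k" ..
    then have "(\<Sum>i=0..n. if i * 3 = n then fps_nth f i else 0)
        = (\<Sum>i=0..n. if i = k then fps_nth f i else 0)"
      by (intro sum.cong) auto
    then show ?thesis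
      using \<open>n = 3 * k\<close> by (simp add: sum.delta)
  next
    case False
    then show ?thesis
      by (auto intro!: sum.neutral)
  qed
  finally show ?thesis .
qed

lemma triple_mult: "triple (f * g) = triple f * triple g" for f g :: "'a::idom fps"
  by (rule fps_compose_mult_distrib) simp

lemma triple_power: "triple (f ^ n) = triple f ^ n" for f :: "'a::idom fps"
  by (rule fps_compose_power [symmetric]) simp

text \<open>Every exponent in \<open>fps_X ^ s * triple f\<close> is congruent to s modulo 3, so
  exactly one residue class survives. Later trisections are computed by writing a series as a sum of
  such terms.\<close>

lemma trisect_X_power_triple:
  assumes "r < 3"
  shows "trisect r (fps_X ^ s * triple f) = (if s mod 3 = r then fps_X ^ (s div 3) * f else 0)"
proof (rule fps_ext)
  fix n
  show "fps_nth (trisect r (fps_X ^ s * triple f)) n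
      = fps_nth (if s mod 3 = r then fps_X ^ (s div 3) * f else 0) n"
  proof (cases "s mod 3 = r")
    case True
    then obtain k where "s = 3 * k + r"
      by (metis div_mult_mod_eq mult.commute)
    then show ?thesis
      using assms by (auto simp: fps_X_power_mult_nth triple_nth simp flip: diff_mult_distrib2)
  next
    case False
    have "\<not> 3 dvd 3 * n + r - s" if "s \<le> 3 * n + r"
    proof
      assume "3 dvd 3 * n + r - s"
      then obtain m where "3 * n + r - s = 3 * m" ..
      then have "s = 3 * (n - m) + r"
        using that assms by (cases "m \<le> n") auto
      then show False
        using False assms by simp
    qed
    then show ?thesis
      using False by (auto simp: fps_X_power_mult_nth triple_nth)
  qed
qed

lemma trisection:
  "f = triple (trisect 0 f) + fps_X * triple (trisect 1 f) + fps_X ^ 2 * triple (trisect 2 f)"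
proof (rule fps_ext)
  fix n :: nat
  have "n = 3 * (n div 3) \<or> n = Suc (3 * (n div 3)) \<or> n = Suc (Suc (3 * (n div 3)))"
    by presburger
  then obtain m where m: "n = 3 * m \<or> n = Suc (3 * m) \<or> n = Suc (Suc (3 * m))"
    by blast
  \<comment> \<open>Truncated subtraction gives 0, a multiple of 3, at m = 0; hence the alternatives
    \<open>m = 0\<close>.\<close>
  have dvd: "\<not> 3 dvd Suc (3 * m)" "\<not> 3 dvd Suc (Suc (3 * m))" "\<not> 3 dvd 3 * m - Suc 0 \<or> m = 0"
    "\<not> 3 dvd 3 * m - 2 \<or> m = 0" "\<not> 3 dvd Suc (3 * m) - 2 \<or> m = 0"
    by presburger+
  from m show "fps_nth f n = fps_nth (triple (trisect 0 f) + fps_X * triple (trisect 1 f)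
      + fps_X ^ 2 * triple (trisect 2 f)) n"
    by (elim disjE) (use dvd in \<open>auto simp: triple_nth fps_X_power_mult_nth\<close>)
qed

lemma trisect_triple: "trisect 0 (triple f) = f" "trisect 1 (triple f) = 0" "trisect 2 (triple f) = 0"
  using trisect_X_power_triple[of _ 0 f] by simp_all

lemma less_three_cases: "r < 3 \<Longrightarrow> r = 0 \<or> r = 1 \<or> r = (2::nat)"
  by linarith

text \<open>Shifting exponents by multiples of 3 preserves residue classes, so extraction is linear
  over the series in q^3.\<close>

lemma trisect_mult_triple: "trisect r (f * triple g) = trisect r f * g" if "r < 3" for f g :: "'a::idom fps"
proof -
  have "trisect r (f * triple g) = trisect r (fps_X ^ 0 * triple (trisect 0 f * g)
      + fps_X ^ 1 * triple (trisect 1 f * g) + fps_X ^ 2 * triple (trisect 2 f * g))"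
    by (subst trisection[of f]) (simp add: triple_mult algebra_simps)
  also have "\<dots> = trisect r f * g"
    using that less_three_cases[OF that] unfolding trisect_add trisect_X_power_triple[OF that]
    by auto
  finally show ?thesis .
qed

text \<open>The powers from \<open>x ^ 0\<close> to \<open>x ^ 4\<close> stay explicit so that every
  summand has the shape required by \<open>trisect_X_power_triple\<close>; exponents 3 and 4 wrap
  around to residues 0 and 1 with an extra factor \<open>fps_X\<close>.\<close>

lemma trisection_product:
  fixes x :: "'a::comm_ring_1"
  shows "(a + x * b + x ^ 2 * c) * (u + x * v + x ^ 2 * w)
    = x ^ 0 * (a * u) + x ^ 1 * (a * v + b * u) + x ^ 2 * (a * w + b * v + c * u)
      + x ^ 3 * (b * w + c * v) + x ^ 4 * (c * w)"
  by (simp add: algebra_simps power2_eq_square power3_eq_cube power4_eq_xxxx)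

lemma trisect_mult:
  fixes f g :: "'a::idom fps"
  shows "trisect 0 (f * g) = trisect 0 f * trisect 0 g
      + fps_X * (trisect 1 f * trisect 2 g + trisect 2 f * trisect 1 g)"
    and "trisect 1 (f * g) = trisect 0 f * trisect 1 g + trisect 1 f * trisect 0 g
      + fps_X * (trisect 2 f * trisect 2 g)"
    and "trisect 2 (f * g) = trisect 0 f * trisect 2 g + trisect 1 f * trisect 1 g
      + trisect 2 f * trisect 0 g"
proof -
  define a b c where "a = trisect 0 f" "b = trisect 1 f" "c = trisect 2 f"
  define u v w where "u = trisect 0 g" "v = trisect 1 g" "w = trisect 2 g"
  have "f * g = (triple a + fps_X * triple b + fps_X ^ 2 * triple c)
      * (triple u + fps_X * triple v + fps_X ^ 2 * triple w)"
    unfolding a_b_c_def u_v_w_def using trisection[of f] trisection[of g] by metis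
  also have "\<dots> = fps_X ^ 0 * triple (a * u) + fps_X ^ 1 * triple (a * v + b * u)
      + fps_X ^ 2 * triple (a * w + b * v + c * u) + fps_X ^ 3 * triple (b * w + c * v)
      + fps_X ^ 4 * triple (c * w)"
    unfolding triple_mult fps_compose_add_distrib by (rule trisection_product)
  finally have "f * g = \<dots>" .
  moreover have T: "trisect 0 (fps_X ^ s * triple h) = (if s mod 3 = 0 then fps_X ^ (s div 3) * h else 0)"
    "trisect 1 (fps_X ^ s * triple h) = (if s mod 3 = 1 then fps_X ^ (s div 3) * h else 0)"
    "trisect 2 (fps_X ^ s * triple h) = (if s mod 3 = 2 then fps_X ^ (s div 3) * h else 0)"
    for s and h :: "'a fps"
    by (rule trisect_X_power_triple; simp)+
  ultimately show "trisect 0 (f * g) = trisect 0 f * trisect 0 g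
      + fps_X * (trisect 1 f * trisect 2 g + trisect 2 f * trisect 1 g)"
    "trisect 1 (f * g) = trisect 0 f * trisect 1 g + trisect 1 f * trisect 0 g
      + fps_X * (trisect 2 f * trisect 2 g)"
    "trisect 2 (f * g) = trisect 0 f * trisect 2 g + trisect 1 f * trisect 1 g
      + trisect 2 f * trisect 0 g"
    unfolding a_b_c_def[symmetric] u_v_w_def[symmetric]
    by (simp_all only: trisect_add T) simp_all
qed

text \<open>The norm from the series in \<open>q\<close> to the series in \<open>q\<^sup>3\<close>, written in the variable \<open>q\<^sup>3\<close>:
  the product of the conjugates \<open>f(\<omega>\<^sup>i q)\<close> for a cube root of unity \<open>\<omega>\<close>.\<close>

definition cubic_norm :: "'a::comm_ring_1 fps \<Rightarrow> 'a fps"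
  where "cubic_norm f = trisect 0 f ^ 3 + fps_X * trisect 1 f ^ 3 + fps_X ^ 2 * trisect 2 f ^ 3
    - 3 * fps_X * trisect 0 f * trisect 1 f * trisect 2 f"

text \<open>Multiplicativity of the norm as a polynomial identity in the six components, which
  avoids adjoining a cube root of unity.\<close>

lemma cubic_norm_identity:
  fixes x :: "'a::comm_ring_1"
  shows "(a * u + x * (b * w + c * v)) ^ 3 + x * (a * v + b * u + x * (c * w)) ^ 3
      + x ^ 2 * (a * w + b * v + c * u) ^ 3
      - 3 * x * (a * u + x * (b * w + c * v)) * (a * v + b * u + x * (c * w)) * (a * w + b * v + c * u)
    = (a ^ 3 + x * b ^ 3 + x ^ 2 * c ^ 3 - 3 * x * a * b * c)
      * (u ^ 3 + x * v ^ 3 + x ^ 2 * w ^ 3 - 3 * x * u * v * w)"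
  by (simp add: algebra_simps power2_eq_square power3_eq_cube)

lemma cubic_norm_mult: "cubic_norm (f * g) = cubic_norm f * cubic_norm g" for f g :: "'a::idom fps"
  unfolding cubic_norm_def trisect_mult by (rule cubic_norm_identity)

lemma cubic_norm_1 [simp]: "cubic_norm 1 = 1"
  using trisect_triple[of "1 :: 'a fps"] by (simp add: cubic_norm_def)

lemma cubic_norm_power: "cubic_norm (f ^ n) = cubic_norm f ^ n" for f :: "'a::idom fps"
  by (induction n) (simp_all add: cubic_norm_mult)

lemma tendsto_cubic_norm:
  fixes f :: "'b \<Rightarrow> 'a::idom fps"
  assumes "(f \<longlongrightarrow> a) F"
  shows "((\<lambda>x. cubic_norm (f x)) \<longlongrightarrow> cubic_norm a) F"
proof -
  have "((\<lambda>x. trisect 0 (f x) ^ 3 + fps_X * trisect 1 (f x) ^ 3 + fps_X ^ 2 * trisect 2 (f x) ^ 3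
      + (- 3 * fps_X) * (trisect 0 (f x) * trisect 1 (f x) * trisect 2 (f x))) \<longlongrightarrow>
    trisect 0 a ^ 3 + fps_X * trisect 1 a ^ 3 + fps_X ^ 2 * trisect 2 a ^ 3
      + (- 3 * fps_X) * (trisect 0 a * trisect 1 a * trisect 2 a)) F"
    by (intro tendsto_fps_add tendsto_fps_mult tendsto_fps_power tendsto_trisect tendsto_const assms)
  then show ?thesis
    by (simp add: cubic_norm_def algebra_simps)
qed

lemma trisect_one_minus_X_power:
  assumes "r < 3"
  shows "trisect r (1 - fps_X ^ n :: 'a::idom fps)
    = (if r = 0 then 1 else 0) - (if n mod 3 = r then fps_X ^ (n div 3) else 0)"
  using trisect_X_power_triple[OF assms, of 0 "1 :: 'a fps"]
    trisect_X_power_triple[OF assms, of n "1 :: 'a fps"]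
  by (auto simp: trisect_diff)

text \<open>If 3 divides n, all conjugates of 1 - q^n coincide; otherwise their product is 1 -
  q^(3n). Rewriting in the variable q^3 gives the two cases.\<close>

lemma cubic_norm_one_minus_X_power:
  "cubic_norm (1 - fps_X ^ n :: 'a::idom fps)
    = (if 3 dvd n then (1 - fps_X ^ (n div 3)) ^ 3 else 1 - fps_X ^ n)"
proof -
  have "n = 3 * (n div 3) \<or> n = 3 * (n div 3) + 1 \<or> n = 3 * (n div 3) + 2"
    by presburger
  then obtain k where k: "n = 3 * k \<or> n = 3 * k + 1 \<or> n = 3 * k + 2"
    by blast
  have cube: "(fps_X :: 'a fps) ^ (3 * k) = (fps_X ^ k) ^ 3"
    by (simp add: mult.commute flip: power_mult)
  from k show ?thesis
  proof (elim disjE)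
    assume "n = 3 * k"
    then show ?thesis
      by (simp add: cubic_norm_def trisect_one_minus_X_power)
  next
    assume n: "n = 3 * k + 1"
    then have "n mod 3 = 1" "n div 3 = k" "\<not> 3 dvd n"
      by presburger+
    then have "cubic_norm (1 - fps_X ^ n :: 'a fps) = 1 - fps_X * (fps_X ^ k) ^ 3"
      by (simp add: cubic_norm_def trisect_one_minus_X_power)
    moreover have "(fps_X :: 'a fps) ^ n = fps_X * (fps_X ^ k) ^ 3"
      unfolding n power_add cube by (simp add: mult.commute)
    ultimately show ?thesis
      using \<open>\<not> 3 dvd n\<close> by simp
  next
    assume n: "n = 3 * k + 2"
    then have "n mod 3 = 2" "n div 3 = k" "\<not> 3 dvd n"
      by presburger+
    then have "cubic_norm (1 - fps_X ^ n :: 'a fps) = 1 - fps_X ^ 2 * (fps_X ^ k) ^ 3"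
      by (simp add: cubic_norm_def trisect_one_minus_X_power)
    moreover have "(fps_X :: 'a fps) ^ n = fps_X ^ 2 * (fps_X ^ k) ^ 3"
      unfolding n power_add cube by (simp add: mult.commute)
    ultimately show ?thesis
      using \<open>\<not> 3 dvd n\<close> by simp
  qed
qed

section \<open>Euler's product\<close>

definition qpoch :: "'a::comm_ring_1 \<Rightarrow> nat \<Rightarrow> 'a"
  where "qpoch q n = (\<Prod>k<n. 1 - q ^ Suc k)"

lemma qpoch_0 [simp]: "qpoch q 0 = 1"
  by (simp add: qpoch_def)

lemma qpoch_Suc [simp]: "qpoch q (Suc n) = qpoch q n * (1 - q ^ Suc n)"
  by (simp add: qpoch_def)

definition euler :: "'a::idom fps"
  where "euler = qpoch_inf fps_X fps_X"

lemma qpoch_tendsto_euler: "(\<lambda>n. qpoch fps_X n) \<longlonglongrightarrow> (euler :: 'a::idom fps)"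
  using has_prod_imp_tendsto'[OF qpoch_inf_fps_has_prod(1)[of "fps_X :: 'a fps" fps_X]]
  by (simp add: qpoch_def euler_def)

lemma euler_nth_0 [simp]: "fps_nth euler 0 = 1"
  by (simp add: euler_def qpoch_inf_fps_has_prod)

lemma qpoch_compose: "qpoch fps_X n oo fps_X ^ m = qpoch (fps_X ^ m :: 'a::idom fps) n" if "m > 0"
  using that
  by (simp add: qpoch_def fps_compose_prod_distrib fps_compose_sub_distrib fps_X_power_compose
      del: power_Suc)

lemma qpoch_inf_X_power:
  assumes "m > 0"
  shows "qpoch_inf (fps_X ^ m) (fps_X ^ m) = (euler oo fps_X ^ m :: 'a::idom fps)"
proof (rule LIMSEQ_unique)
  show "(\<lambda>n. qpoch (fps_X ^ m) n) \<longlonglongrightarrow> (qpoch_inf (fps_X ^ m) (fps_X ^ m) :: 'a fps)"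
    using has_prod_imp_tendsto'[OF qpoch_inf_fps_has_prod(1)[of "fps_X ^ m :: 'a fps" "fps_X ^ m"]] assms
    by (simp add: qpoch_def)
  show "(\<lambda>n. qpoch (fps_X ^ m) n) \<longlonglongrightarrow> (euler oo fps_X ^ m :: 'a fps)"
    using tendsto_fps_compose[OF qpoch_tendsto_euler, of "fps_X ^ m"] assms
    by (simp add: qpoch_compose)
qed

lemma triple_triple: "triple (triple f) = f oo fps_X ^ 9" for f :: "'a::idom fps"
  using fps_compose_assoc[of "fps_X ^ 3 :: 'a fps" "fps_X ^ 3" f]
  by (simp add: fps_X_power_compose flip: power_mult)

text \<open>Among the exponents 1, ..., 3n the multiples 3j turn into cubes of 1 - q^j, while the
  other factors are their own norms. Multiplying by \<open>qpoch (fps_X ^ 3) n\<close> restores the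
  missing factors 1 - q^(3j).\<close>

lemma cubic_norm_qpoch:
  "cubic_norm (qpoch fps_X (3 * n)) * qpoch (fps_X ^ 3) n
    = qpoch fps_X (3 * n) * qpoch (fps_X :: 'a::idom fps) n ^ 3"
proof (induction n)
  case (Suc n)
  have Suc3: "3 * Suc n = Suc (Suc (Suc (3 * n)))" by simp
  then have q: "qpoch q (3 * Suc n) = qpoch q (3 * n)
      * ((1 - q ^ (Suc (3 * n))) * (1 - q ^ (Suc (Suc (3 * n)))) * (1 - q ^ (Suc (Suc (Suc (3 * n))))))" for q :: "'a fps"
    by (simp only: Suc3 qpoch_Suc mult.assoc)
  have "\<not> 3 dvd Suc (3 * n)" "\<not> 3 dvd Suc (Suc (3 * n))" "3 dvd Suc (Suc (Suc (3 * n)))" "(Suc (Suc (Suc (3 * n)))) div 3 = Suc n"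
    by presburger+
  then have "cubic_norm (qpoch fps_X (3 * Suc n) :: 'a fps) = cubic_norm (qpoch fps_X (3 * n))
      * ((1 - fps_X ^ (Suc (3 * n))) * (1 - fps_X ^ (Suc (Suc (3 * n)))) * (1 - fps_X ^ Suc n) ^ 3)"
    by (simp only: q cubic_norm_mult cubic_norm_one_minus_X_power if_True if_False)
  moreover have "qpoch (fps_X ^ 3 :: 'a fps) (Suc n) = qpoch (fps_X ^ 3) n * (1 - fps_X ^ (Suc (Suc (Suc (3 * n)))))"
    by (simp only: qpoch_Suc flip: Suc3 power_mult)
  ultimately have "cubic_norm (qpoch fps_X (3 * Suc n) :: 'a fps) * qpoch (fps_X ^ 3) (Suc n)
      = (cubic_norm (qpoch fps_X (3 * n)) * qpoch (fps_X ^ 3) n)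
        * ((1 - fps_X ^ (Suc (3 * n))) * (1 - fps_X ^ (Suc (Suc (3 * n)))) * (1 - fps_X ^ (Suc (Suc (Suc (3 * n))))))
        * (1 - fps_X ^ Suc n) ^ 3"
    by (simp only: mult_ac)
  also have "\<dots> = qpoch fps_X (3 * Suc n) * qpoch (fps_X :: 'a fps) (Suc n) ^ 3"
    unfolding Suc.IH q qpoch_Suc power_mult_distrib by (simp only: mult_ac)
  finally show ?case .
qed simp

text \<open>The limit of \<open>cubic_norm_qpoch\<close>, taken along the subsequence 3n. Written in
  q^3, it is the source of the quotient E(q^3)^4 / E(q^9).\<close>

lemma cubic_norm_euler: "cubic_norm euler * triple euler = (euler :: 'a::idom fps) ^ 4"
proof (rule LIMSEQ_unique)
  have sub: "(\<lambda>n. qpoch fps_X (3 * n)) \<longlonglongrightarrow> (euler :: 'a fps)"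
    using LIMSEQ_subseq_LIMSEQ[OF qpoch_tendsto_euler, of "\<lambda>n. 3 * n"]
    by (simp add: strict_mono_def o_def)
  have "(\<lambda>n. qpoch (fps_X ^ 3) n) \<longlonglongrightarrow> (triple euler :: 'a fps)"
    using tendsto_fps_compose[OF qpoch_tendsto_euler, of "fps_X ^ 3"] by (simp add: qpoch_compose)
  then show "(\<lambda>n. cubic_norm (qpoch fps_X (3 * n)) * qpoch (fps_X ^ 3) n)
      \<longlonglongrightarrow> cubic_norm euler * (triple euler :: 'a fps)"
    by (intro tendsto_fps_mult tendsto_cubic_norm sub)
  have "(\<lambda>n. qpoch fps_X (3 * n) * qpoch fps_X n ^ 3) \<longlonglongrightarrow> euler * (euler :: 'a fps) ^ 3"
    by (intro tendsto_fps_mult tendsto_fps_power sub qpoch_tendsto_euler)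
  then show "(\<lambda>n. cubic_norm (qpoch fps_X (3 * n)) * qpoch (fps_X ^ 3) n) \<longlonglongrightarrow> (euler :: 'a fps) ^ 4"
    by (simp add: cubic_norm_qpoch flip: power_Suc)
qed

section \<open>Jacobi's identity for the cube of Euler's product\<close>

text \<open>The q-Pascal recursion replaces the quotient of q-factorials, so that the coefficient
  makes sense in every commutative ring.\<close>

fun gauss_binomial :: "'a::comm_ring_1 \<Rightarrow> nat \<Rightarrow> nat \<Rightarrow> 'a" where
  "gauss_binomial q n 0 = 1"
| "gauss_binomial q 0 (Suc k) = 0"
| "gauss_binomial q (Suc n) (Suc k) = gauss_binomial q n k + q ^ Suc k * gauss_binomial q n (Suc k)"

lemma gauss_binomial_eq_0: "n < k \<Longrightarrow> gauss_binomial q n k = 0"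
  by (induction q n k rule: gauss_binomial.induct) auto

text \<open>The second q-Pascal rule: expand by the first rule and apply the induction hypothesis to
  both entries. For j = n the second entry lies outside its row and vanishes.\<close>

lemma gauss_binomial_Suc_Suc':
  "k \<le> n \<Longrightarrow> gauss_binomial q (Suc n) (Suc k)
    = q ^ (n - k) * gauss_binomial q n k + gauss_binomial q n (Suc k)"
proof (induction n arbitrary: k)
  case (Suc n)
  show ?case
  proof (cases k)
    case 0
    with Suc.IH[of 0] show ?thesis
      by (simp add: algebra_simps)
  next
    case (Suc j)
    then have "j \<le> n" using Suc.prems by simp
    have "gauss_binomial q (Suc n) (Suc (Suc j))
        = q ^ (n - Suc j) * gauss_binomial q n (Suc j) + gauss_binomial q n (Suc (Suc j))" if "j < n"
      using that by (intro Suc.IH) simp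
    moreover have "q ^ Suc (Suc j) * q ^ (n - Suc j) = q ^ (n - j) * q ^ Suc j" if "j < n"
      using that by (simp flip: power_add power_Suc)
    ultimately have *: "q ^ Suc (Suc j) * gauss_binomial q (Suc n) (Suc (Suc j))
        = q ^ (n - j) * q ^ Suc j * gauss_binomial q n (Suc j)
          + q ^ Suc (Suc j) * gauss_binomial q n (Suc (Suc j))"
      using \<open>j \<le> n\<close>
      by (cases "j < n") (simp_all only: distrib_left flip: mult.assoc, simp_all add: gauss_binomial_eq_0)
    have "gauss_binomial q (Suc (Suc n)) (Suc (Suc j)) = q ^ (n - j) * gauss_binomial q n j
        + gauss_binomial q n (Suc j) + q ^ Suc (Suc j) * gauss_binomial q (Suc n) (Suc (Suc j))"
      using Suc.IH[OF \<open>j \<le> n\<close>] by simp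
    also have "\<dots> = q ^ (n - j) * gauss_binomial q (Suc n) (Suc j) + gauss_binomial q (Suc n) (Suc (Suc j))"
      unfolding * by (simp add: algebra_simps)
    finally show ?thesis
      using Suc by simp
  qed
qed simp

lemma gauss_binomial_qpoch:
  "k \<le> n \<Longrightarrow> gauss_binomial q n k * qpoch q k * qpoch q (n - k) = qpoch q n"
proof (induction q n k rule: gauss_binomial.induct)
  case (3 q n k)
  have IH: "gauss_binomial q n k * qpoch q k * qpoch q (n - k) = qpoch q n"
    using 3 by simp
  have "gauss_binomial q n (Suc k) * qpoch q (Suc k) * qpoch q (n - k) = qpoch q n * (1 - q ^ (n - k))"
  proof (cases "k < n")
    case True
    then have "n - k = Suc (n - Suc k)" by simp
    then have "qpoch q (n - k) = qpoch q (n - Suc k) * (1 - q ^ (n - k))"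
      by (metis qpoch_Suc)
    then show ?thesis
      using 3(2) True by (metis Suc_leI mult.assoc)
  qed (use 3 in \<open>simp add: gauss_binomial_eq_0\<close>)
  moreover have "q ^ Suc k * q ^ (n - k) = q ^ Suc n"
    using 3 by (simp flip: power_add power_Suc)
  ultimately have *: "q ^ Suc k * (gauss_binomial q n (Suc k) * qpoch q (Suc k) * qpoch q (n - k))
      = qpoch q n * (q ^ Suc k - q ^ Suc n)"
    by (metis (no_types, opaque_lifting) mult.left_commute right_diff_distrib mult.right_neutral)
  have "gauss_binomial q (Suc n) (Suc k) * qpoch q (Suc k) * qpoch q (Suc n - Suc k)
      = (gauss_binomial q n k * qpoch q k * qpoch q (n - k)) * (1 - q ^ Suc k)
        + q ^ Suc k * (gauss_binomial q n (Suc k) * qpoch q (Suc k) * qpoch q (n - k))"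
    by (simp add: algebra_simps)
  also have "\<dots> = qpoch q (Suc n)"
    unfolding IH * by (simp add: algebra_simps)
  finally show ?case .
qed auto

lemma qpoch_X_nonzero [simp]: "qpoch fps_X n \<noteq> (0 :: 'a::idom fps)"
proof -
  have "fps_nth (qpoch fps_X n :: 'a fps) 0 = 1"
    by (induction n) simp_all
  then show ?thesis by (metis fps_zero_nth zero_neq_one)
qed

text \<open>Both sides have the same closed form by \<open>gauss_binomial_qpoch\<close>. Cancelling
  the \<open>qpoch\<close> factors is the reason for specialising q to \<open>fps_X\<close>.\<close>

lemma gauss_binomial_middle:
  "gauss_binomial fps_X (2 * n + 1) (Suc n) = gauss_binomial (fps_X :: 'a::idom fps) (2 * n + 1) n"
proof -
  have "2 * n + 1 - n = Suc n" "2 * n + 1 - Suc n = n" by simp_all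
  then have "gauss_binomial fps_X (2 * n + 1) (Suc n) * (qpoch (fps_X :: 'a fps) (Suc n) * qpoch fps_X n)
      = gauss_binomial fps_X (2 * n + 1) n * (qpoch fps_X (Suc n) * qpoch fps_X n)"
    using gauss_binomial_qpoch[of "Suc n" "2 * n + 1" "fps_X :: 'a fps"]
      gauss_binomial_qpoch[of n "2 * n + 1" "fps_X :: 'a fps"]
    by (simp del: qpoch_Suc gauss_binomial.simps add: mult_ac)
  then show ?thesis
    by (subst (asm) mult_cancel_right) (simp del: qpoch_Suc gauss_binomial.simps)
qed

definition jacobi_term :: "'a::comm_ring_1 \<Rightarrow> nat \<Rightarrow> 'a"
  where "jacobi_term q i = (-1) ^ i * of_nat (2 * i + 1) * q ^ triangle i"

text \<open>The first q-Pascal rule followed by the second one on both entries. Passing from row 2n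
  + 1 to row 2n + 3 stays within the odd rows of \<open>jacobi_finite\<close>.\<close>

lemma gauss_binomial_two_steps:
  assumes "i \<le> n + 1"
  shows "gauss_binomial q (2 * n + 3) (n + 2 + i)
    = q ^ (n + 1 - i) * gauss_binomial q (2 * n + 1) (n + i)
      + (1 + q ^ (2 * n + 2)) * gauss_binomial q (2 * n + 1) (n + 1 + i)
      + q ^ (n + 2 + i) * gauss_binomial q (2 * n + 1) (n + 2 + i)"
proof -
  have "gauss_binomial q (Suc (2 * n + 1)) (Suc (n + i)) = q ^ (2 * n + 1 - (n + i))
      * gauss_binomial q (2 * n + 1) (n + i) + gauss_binomial q (2 * n + 1) (Suc (n + i))"
    using assms by (intro gauss_binomial_Suc_Suc') simp
  moreover have "2 * n + 1 - (n + i) = n + 1 - i" by simp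
  ultimately have 1: "gauss_binomial q (2 * n + 2) (n + 1 + i)
      = q ^ (n + 1 - i) * gauss_binomial q (2 * n + 1) (n + i) + gauss_binomial q (2 * n + 1) (n + 1 + i)"
    by (simp del: gauss_binomial.simps)
  have 2: "q ^ (n + 2 + i) * gauss_binomial q (2 * n + 2) (n + 2 + i)
      = q ^ (2 * n + 2) * gauss_binomial q (2 * n + 1) (n + 1 + i)
        + q ^ (n + 2 + i) * gauss_binomial q (2 * n + 1) (n + 2 + i)"
  proof (cases "i \<le> n")
    case True
    then have "gauss_binomial q (Suc (2 * n + 1)) (Suc (n + 1 + i)) = q ^ (2 * n + 1 - (n + 1 + i))
        * gauss_binomial q (2 * n + 1) (n + 1 + i) + gauss_binomial q (2 * n + 1) (Suc (n + 1 + i))"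
      by (intro gauss_binomial_Suc_Suc') simp
    moreover have "2 * n + 1 - (n + 1 + i) = n - i" by simp
    ultimately have "gauss_binomial q (2 * n + 2) (n + 2 + i)
        = q ^ (n - i) * gauss_binomial q (2 * n + 1) (n + 1 + i) + gauss_binomial q (2 * n + 1) (n + 2 + i)"
      by (simp del: gauss_binomial.simps)
    moreover have "n + 2 + i + (n - i) = 2 * n + 2"
      using True by simp
    then have "q ^ (n + 2 + i) * q ^ (n - i) = q ^ (2 * n + 2)"
      by (simp only: flip: power_add)
    ultimately show ?thesis
      by (simp only: distrib_left flip: mult.assoc)
  next
    case False
    then show ?thesis
      by (simp add: gauss_binomial_eq_0 del: gauss_binomial.simps)
  qed
  have "gauss_binomial q (Suc (2 * n + 2)) (Suc (n + 1 + i))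
      = gauss_binomial q (2 * n + 2) (n + 1 + i) + q ^ (n + 2 + i) * gauss_binomial q (2 * n + 2) (n + 2 + i)"
    by simp
  also have "\<dots> = q ^ (n + 1 - i) * gauss_binomial q (2 * n + 1) (n + i)
      + (1 + q ^ (2 * n + 2)) * gauss_binomial q (2 * n + 1) (n + 1 + i)
      + q ^ (n + 2 + i) * gauss_binomial q (2 * n + 1) (n + 2 + i)"
    unfolding 1 2 by (simp only: distrib_right mult_1_left add_ac)
  finally show ?thesis
    by (simp add: eval_nat_numeral del: gauss_binomial.simps)
qed

text \<open>A finite form of Jacobi's identity. In the induction, the two-step recurrence expands
  row 2n + 3 in row 2n + 1; after reindexing, each entry has coefficient
  \<open>(1 - q ^ Suc n) ^ 2 * jacobi_term q i\<close>.\<close>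

lemma jacobi_finite:
  fixes q :: "'a::comm_ring_1"
  assumes middle: "\<And>n. gauss_binomial q (2 * n + 1) (Suc n) = gauss_binomial q (2 * n + 1) n"
  shows "(\<Sum>i\<le>n. jacobi_term q i * gauss_binomial q (2 * n + 1) (n + 1 + i)) = qpoch q n ^ 2"
proof (induction n)
  case 0
  show ?case by (simp add: jacobi_term_def)
next
  case (Suc n)
  define F where "F i = gauss_binomial q (2 * n + 1) (n + 1 + i)" for i
  \<comment> \<open>Chosen so that \<open>v (Suc i) = w i * q ^ (n + 2 + i)\<close>. The shifted sum
    then lacks its term at 0, where \<open>v 0 = q ^ (n + 1)\<close>.\<close>
  define v where "v i = - ((-1) ^ i * (of_nat (2 * i) - 1) * q ^ (triangle i + n + 1))" for i
  define w where "w = jacobi_term q"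
  have F0: "F i = 0" if "i > n" for i
    using that by (simp add: F_def gauss_binomial_eq_0 del: gauss_binomial.simps)
  \<comment> \<open>The term i = 0 contains the entry n of the row, which equals \<open>F 0\<close>
    by the symmetry \<open>middle\<close>. It cancels the boundary term of the third sum.\<close>
  have "(\<Sum>i\<le>Suc n. w i * (q ^ (n + 1 - i) * gauss_binomial q (2 * n + 1) (n + i)))
      = q ^ (n + 1) * F 0 + (\<Sum>i\<le>n. w (Suc i) * q ^ (n - i) * F i)"
    unfolding sum.atMost_Suc_shift using middle[of n]
    by (simp add: w_def jacobi_term_def F_def mult.assoc del: gauss_binomial.simps)
  moreover have "(\<Sum>i\<le>Suc n. w i * ((1 + q ^ (2 * n + 2)) * F i))
      = (\<Sum>i\<le>n. w i * (1 + q ^ (2 * n + 2)) * F i)"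
    by (simp add: F0 mult.assoc)
  moreover have "(\<Sum>i\<le>Suc n. w i * (q ^ (n + 2 + i) * F (Suc i)))
      = (\<Sum>i\<le>n. v i * F i) - q ^ (n + 1) * F 0"
  proof -
    have "w i * q ^ (n + 2 + i) = v (Suc i)" for i
      by (simp add: w_def v_def jacobi_term_def power_add mult_ac)
    then have "(\<Sum>i\<le>Suc n. w i * (q ^ (n + 2 + i) * F (Suc i))) = (\<Sum>i\<le>Suc n. v (Suc i) * F (Suc i))"
      by (simp only: flip: mult.assoc)
    also have "\<dots> = (\<Sum>i\<le>Suc (Suc n). v i * F i) - v 0 * F 0"
      by (subst sum.atMost_Suc_shift[of _ "Suc n"]) simp
    also have "\<dots> = (\<Sum>i\<le>n. v i * F i) - q ^ (n + 1) * F 0"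
      by (simp add: F0) (simp add: v_def)
    finally show ?thesis .
  qed
  moreover have "(\<Sum>i\<le>Suc n. jacobi_term q i * gauss_binomial q (2 * Suc n + 1) (Suc n + 1 + i))
    = (\<Sum>i\<le>Suc n. w i * (q ^ (n + 1 - i) * gauss_binomial q (2 * n + 1) (n + i)))
      + (\<Sum>i\<le>Suc n. w i * ((1 + q ^ (2 * n + 2)) * F i))
      + (\<Sum>i\<le>Suc n. w i * (q ^ (n + 2 + i) * F (Suc i)))"
    unfolding sum.distrib[symmetric]
  proof (rule sum.cong)
    fix i assume "i \<in> {..Suc n}"
    then have i: "i \<le> n + 1" by simp
    have "gauss_binomial q (2 * Suc n + 1) (Suc n + 1 + i) = gauss_binomial q (2 * n + 3) (n + 2 + i)"
      by (simp only: eval_nat_numeral) simp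
    also note gauss_binomial_two_steps[OF i, of q]
    finally show "jacobi_term q i * gauss_binomial q (2 * Suc n + 1) (Suc n + 1 + i)
      = w i * (q ^ (n + 1 - i) * gauss_binomial q (2 * n + 1) (n + i))
      + w i * ((1 + q ^ (2 * n + 2)) * F i) + w i * (q ^ (n + 2 + i) * F (Suc i))"
      by (simp add: w_def F_def distrib_left del: gauss_binomial.simps)
  qed simp
  ultimately have "(\<Sum>i\<le>Suc n. jacobi_term q i * gauss_binomial q (2 * Suc n + 1) (Suc n + 1 + i))
    = (\<Sum>i\<le>n. w (Suc i) * q ^ (n - i) * F i) + (\<Sum>i\<le>n. w i * (1 + q ^ (2 * n + 2)) * F i)
      + (\<Sum>i\<le>n. v i * F i)"
    by simp
  also have "\<dots> = (\<Sum>i\<le>n. (w (Suc i) * q ^ (n - i) + w i * (1 + q ^ (2 * n + 2)) + v i) * F i)"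
    by (simp only: sum.distrib distrib_right)
  also have "\<dots> = (\<Sum>i\<le>n. (1 - q ^ Suc n) ^ 2 * (w i * F i))"
  proof (rule sum.cong)
    fix i assume "i \<in> {..n}"
    then have T: "q ^ triangle (Suc i) * q ^ (n - i) = q ^ triangle i * q ^ Suc n"
      by (simp flip: power_add power_Suc)
    \<comment> \<open>The three contributions are -(c + 3) Q, (c + 1) (1 + Q^2) and -(c - 1) Q, each
      times t; they add up to (c + 1) (1 - Q)^2 t.\<close>
    define c t Q where "c = (of_nat (2 * i) :: 'a)" and "t = (-1) ^ i * q ^ triangle i" and "Q = q ^ Suc n"
    have "w (Suc i) * q ^ (n - i) = - ((-1) ^ i * (c + 3) * (q ^ triangle (Suc i) * q ^ (n - i)))"
      by (simp add: w_def jacobi_term_def c_def algebra_simps del: triangle_Suc)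
    then have 1: "w (Suc i) * q ^ (n - i) = - ((c + 3) * (t * Q))"
      unfolding T by (simp only: t_def Q_def mult_ac)
    have 2: "v i = - ((c - 1) * (t * Q))"
      by (simp add: v_def c_def t_def Q_def power_add mult_ac)
    have 3: "w i = (c + 1) * t"
      by (simp add: w_def jacobi_term_def c_def t_def algebra_simps)
    have "2 * n + 2 = Suc n + Suc n" by simp
    then have 4: "q ^ (2 * n + 2) = Q * Q"
      by (simp only: Q_def power_add)
    have "w (Suc i) * q ^ (n - i) + w i * (1 + q ^ (2 * n + 2)) + v i = (1 - q ^ Suc n) ^ 2 * w i"
      unfolding 1 2 3 4 Q_def[symmetric] by (simp add: algebra_simps power2_eq_square)
    then show "(w (Suc i) * q ^ (n - i) + w i * (1 + q ^ (2 * n + 2)) + v i) * F i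
        = (1 - q ^ Suc n) ^ 2 * (w i * F i)"
      by (simp only: mult.assoc)
  qed simp
  also have "\<dots> = (1 - q ^ Suc n) ^ 2 * qpoch q n ^ 2"
    using Suc.IH by (simp add: w_def F_def flip: sum_distrib_left del: gauss_binomial.simps)
  finally show ?case
    by (simp only: qpoch_Suc power_mult_distrib mult.commute)
qed

section \<open>Passage to the limit in the finite Jacobi identity\<close>

text \<open>The quotient is the product of the factors 1 - q^k with d < k \<le> a, hence 1 +
  O(q^(d+1)).\<close>

lemma X_power_dvd_qpoch_quotient:
  assumes "d \<le> a"
  shows "\<exists>r. qpoch fps_X a = qpoch fps_X d * r \<and> fps_X ^ Suc d dvd r - (1 :: 'a::comm_ring_1 fps)"
  using assms
proof (induction a rule: dec_induct)
  case base
  show ?case by (intro exI[of _ 1]) simp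
next
  case (step a)
  then obtain r :: "'a fps" where r: "qpoch fps_X a = qpoch fps_X d * r" "fps_X ^ Suc d dvd r - 1"
    by blast
  have "fps_X ^ Suc d dvd (fps_X :: 'a fps) ^ Suc a"
    using step by (intro le_imp_power_dvd) simp
  then have "fps_X ^ Suc d dvd (r - 1) - r * fps_X ^ Suc a"
    by (intro dvd_diff[OF r(2)] dvd_mult)
  also have "(r - 1) - r * fps_X ^ Suc a = r * (1 - fps_X ^ Suc a) - 1"
    by (simp add: algebra_simps)
  finally show ?case
    using r(1) by (intro exI[of _ "r * (1 - fps_X ^ Suc a)"] conjI) (simp_all only: qpoch_Suc mult.assoc)
qed

text \<open>With d = n - i, the closed form of the binomial times \<open>qpoch fps_X n\<close> is a
  quotient of four q-factorials, each equal to \<open>qpoch fps_X d\<close> times 1 + O(q^(d+1)).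
  The common factors cancel.\<close>

lemma X_power_dvd_gauss_binomial:
  assumes "i \<le> n"
  shows "fps_X ^ Suc (n - i) dvd
    gauss_binomial fps_X (2 * n + 1) (n + 1 + i) * qpoch fps_X n - (1 :: 'a::idom fps)"
proof -
  define d where "d = n - i"
  have "d \<le> n" "d \<le> n + 1 + i" "d \<le> 2 * n + 1"
    using assms by (simp_all add: d_def)
  then obtain r1 r2 r3 :: "'a fps" where
    r: "qpoch fps_X n = qpoch fps_X d * r1" "qpoch fps_X (n + 1 + i) = qpoch fps_X d * r2"
      "qpoch fps_X (2 * n + 1) = qpoch fps_X d * r3"
    and dvd: "fps_X ^ Suc d dvd r1 - 1" "fps_X ^ Suc d dvd r2 - 1" "fps_X ^ Suc d dvd r3 - 1"
    by (meson X_power_dvd_qpoch_quotient)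
  define g where "g = gauss_binomial (fps_X :: 'a fps) (2 * n + 1) (n + 1 + i)"
  have "2 * n + 1 - (n + 1 + i) = d"
    using assms by (simp add: d_def)
  then have "g * (qpoch fps_X d * r2) * qpoch fps_X d = qpoch fps_X d * r3"
    using gauss_binomial_qpoch[of "n + 1 + i" "2 * n + 1" "fps_X :: 'a fps"] assms
    unfolding g_def r[symmetric] by (simp del: qpoch_Suc gauss_binomial.simps)
  then have "qpoch fps_X d * (g * r2 * qpoch fps_X d) = qpoch fps_X d * r3"
    by (simp only: mult_ac)
  then have "g * r2 * qpoch fps_X d = r3"
    by simp
  then have "g * qpoch fps_X n - 1 = (r3 - 1) * r1 + (r1 - 1) - g * qpoch fps_X n * (r2 - 1)"
    unfolding r by (auto simp: algebra_simps)
  then show ?thesis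
    using dvd unfolding g_def d_def by (simp only: dvd_add dvd_diff dvd_mult dvd_mult2)
qed

lemma le_triangle: "n \<le> triangle n"
  by (induction n) simp_all

text \<open>Multiply \<open>jacobi_finite\<close> by \<open>qpoch fps_X n\<close>. Term i contains q
  to the power \<open>triangle i\<close>, which is at least i, and its second factor deviates from 1
  by O(q^(n-i+1)); so the total error is O(q^(n+1)).\<close>

lemma X_power_dvd_jacobi:
  "fps_X ^ Suc n dvd qpoch fps_X n ^ 3 - (\<Sum>i\<le>n. jacobi_term (fps_X :: 'a::idom fps) i)"
proof -
  have "qpoch fps_X n ^ 3 = (\<Sum>i\<le>n. jacobi_term (fps_X :: 'a fps) i
      * gauss_binomial fps_X (2 * n + 1) (n + 1 + i)) * qpoch fps_X n"
    unfolding jacobi_finite[OF gauss_binomial_middle] by (simp add: power2_eq_square power3_eq_cube)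
  then have "qpoch fps_X n ^ 3 - (\<Sum>i\<le>n. jacobi_term (fps_X :: 'a fps) i)
    = (\<Sum>i\<le>n. jacobi_term fps_X i * (gauss_binomial fps_X (2 * n + 1) (n + 1 + i) * qpoch fps_X n - 1))"
    by (simp add: sum_distrib_right sum_subtractf right_diff_distrib mult.assoc del: gauss_binomial.simps)
  also have "fps_X ^ Suc n dvd \<dots>"
  proof (rule dvd_sum)
    fix i assume "i \<in> {..n}"
    then have i: "i \<le> n" by simp
    have "fps_X ^ i dvd jacobi_term (fps_X :: 'a fps) i"
      unfolding jacobi_term_def by (intro dvd_mult le_imp_power_dvd le_triangle)
    then have "fps_X ^ i * fps_X ^ Suc (n - i) dvd jacobi_term (fps_X :: 'a fps) i
        * (gauss_binomial fps_X (2 * n + 1) (n + 1 + i) * qpoch fps_X n - 1)"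
      by (intro mult_dvd_mono X_power_dvd_gauss_binomial i)
    moreover have "i + Suc (n - i) = Suc n" using i by simp
    ultimately show "fps_X ^ Suc n dvd jacobi_term (fps_X :: 'a fps) i
        * (gauss_binomial fps_X (2 * n + 1) (n + 1 + i) * qpoch fps_X n - 1)"
      by (simp only: flip: power_add)
  qed
  finally show ?thesis .
qed

lemma jacobi_euler_cube:
  "fps_nth (euler ^ 3 :: 'a::idom fps) n = (\<Sum>i | triangle i = n. (-1) ^ i * of_nat (2 * i + 1))"
proof -
  have coeff: "fps_nth (jacobi_term fps_X i) n = (if triangle i = n then (-1) ^ i * of_nat (2 * i + 1) else 0 :: 'a)" for i
  proof -
    have "jacobi_term (fps_X :: 'a fps) i = fps_const ((-1) ^ i * of_nat (2 * i + 1)) * fps_X ^ triangle i"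
      by (simp only: jacobi_term_def fps_of_nat fps_const_1_eq_1
          flip: fps_const_power fps_const_neg fps_const_mult)
    then show ?thesis
      by (simp add: fps_X_power_nth)
  qed
  have "\<forall>\<^sub>F m in sequentially. fps_nth (qpoch fps_X m ^ 3) n = fps_nth (euler ^ 3 :: 'a fps) n"
    using tendsto_fps_power[OF qpoch_tendsto_euler, of 3] unfolding tendsto_fps_iff by blast
  \<comment> \<open>A single m serves both purposes: the coefficient at n is already stable, and the
    error term starts beyond n.\<close>
  then obtain m where m: "m \<ge> n" "fps_nth (qpoch fps_X m ^ 3) n = fps_nth (euler ^ 3 :: 'a fps) n"
    unfolding eventually_sequentially by (metis linear)
  obtain f where "qpoch fps_X m ^ 3 - (\<Sum>i\<le>m. jacobi_term (fps_X :: 'a fps) i) = fps_X ^ Suc m * f"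
    using X_power_dvd_jacobi by blast
  then have "qpoch fps_X m ^ 3 = (\<Sum>i\<le>m. jacobi_term (fps_X :: 'a fps) i) + fps_X ^ Suc m * f"
    by (metis add.commute diff_add_cancel)
  then have "fps_nth (euler ^ 3 :: 'a fps) n = (\<Sum>i\<le>m. fps_nth (jacobi_term fps_X i) n)"
    using m by (simp add: fps_X_power_mult_nth fps_sum_nth del: power_Suc)
  also have "\<dots> = (\<Sum>i\<in>{i. triangle i = n}. (-1) ^ i * of_nat (2 * i + 1))"
    unfolding coeff using m le_triangle
    by (intro sum.mono_neutral_cong_right) (auto intro: order.trans)
  finally show ?thesis .
qed

section \<open>Triangular numbers modulo 3 and the trisection of E(q)^3\<close>

lemma triangle_mult_2: "2 * triangle n = n * n + n"
  by (induction n) simp_all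

text \<open>No triangular number is 2 modulo 3, and those that are 1 modulo 3 have the form 9T + 1
  with T triangular. So one residue part of Jacobi's series vanishes and another is again a Jacobi
  series.\<close>

lemma triangle_mod_3:
  "triangle (3 * k) mod 3 = 0" "triangle (3 * k + 1) = 9 * triangle k + 1" "triangle (3 * k + 2) mod 3 = 0"
proof -
  have "2 * triangle (3 * k) = 9 * (k * k) + 3 * k" "2 * triangle (3 * k + 2) = 9 * (k * k) + 15 * k + 6"
    unfolding triangle_mult_2 by (simp_all add: algebra_simps)
  then show "triangle (3 * k) mod 3 = 0" "triangle (3 * k + 2) mod 3 = 0"
    by presburger+
  have "2 * triangle (3 * k + 1) = 9 * (2 * triangle k) + 2"
    unfolding triangle_mult_2 by (simp add: algebra_simps)
  then show "triangle (3 * k + 1) = 9 * triangle k + 1" by simp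
qed

lemma triangle_mod_3_cases:
  "triangle i mod 3 = 0 \<or> (\<exists>k. i = 3 * k + 1 \<and> triangle i = 9 * triangle k + 1)"
proof -
  have "i = 3 * (i div 3) \<or> i = 3 * (i div 3) + 1 \<or> i = 3 * (i div 3) + 2"
    by presburger
  then show ?thesis
    using triangle_mod_3[of "i div 3"] by metis
qed

lemma trisect_2_euler_cube: "trisect 2 (euler ^ 3 :: 'a::idom fps) = 0"
proof (rule fps_ext)
  fix n
  have "triangle i \<noteq> 3 * n + 2" for i
    using triangle_mod_3_cases[of i] by (elim disjE exE conjE) presburger+
  then show "fps_nth (trisect 2 (euler ^ 3 :: 'a fps)) n = fps_nth 0 n"
    by (simp add: jacobi_euler_cube)
qed

text \<open>For i = 3k + 1 the coefficient (-1)^i (2i + 1) is -3 (-1)^k (2k + 1), at the exponent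
  \<open>9 * triangle k + 1\<close>. This part of E(q)^3 is therefore -3 q E(q^9)^3.\<close>

lemma trisect_1_euler_cube: "trisect 1 (euler ^ 3 :: 'a::idom fps) = - 3 * triple euler ^ 3"
proof (rule fps_ext)
  fix n
  have sgn: "(-1) ^ (3 * k + 1) = (- ((-1) ^ k) :: 'a)" for k
    by (simp add: power_mult)
  have "{i. triangle i = 3 * n + 1} = (\<lambda>k. 3 * k + 1) ` {k. 3 * triangle k = n}"
  proof (intro equalityI subsetI)
    fix i assume "i \<in> {i. triangle i = 3 * n + 1}"
    then have i: "triangle i = 3 * n + 1" by simp
    then have "triangle i mod 3 \<noteq> 0" by presburger
    then obtain k where "i = 3 * k + 1" "triangle i = 9 * triangle k + 1"
      using triangle_mod_3_cases[of i] by auto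
    with i show "i \<in> (\<lambda>k. 3 * k + 1) ` {k. 3 * triangle k = n}"
      by (intro image_eqI[of _ _ k]) simp_all
  qed (auto simp: triangle_mod_3[simplified])
  then have "fps_nth (trisect 1 (euler ^ 3 :: 'a fps)) n
      = (\<Sum>k | 3 * triangle k = n. (-1) ^ (3 * k + 1) * of_nat (2 * (3 * k + 1) + 1))"
    unfolding trisect_nth jacobi_euler_cube by (simp only:) (subst sum.reindex, auto simp: inj_on_def)
  also have "\<dots> = (\<Sum>k | 3 * triangle k = n. - 3 * ((-1) ^ k * of_nat (2 * k + 1)))"
    unfolding sgn by (intro sum.cong) (simp_all add: algebra_simps)
  also have "\<dots> = - 3 * fps_nth (triple (euler ^ 3)) n"
  proof (cases "3 dvd n")
    case True
    then obtain m where "n = 3 * m" ..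
    then show ?thesis
      unfolding triple_nth jacobi_euler_cube by (simp add: sum_negf sum_distrib_left)
  next
    case False
    then have "{k. 3 * triangle k = n} = {}" by auto
    with False show ?thesis
      unfolding triple_nth by simp
  qed
  finally show "fps_nth (trisect 1 (euler ^ 3 :: 'a fps)) n = fps_nth (- 3 * triple euler ^ 3) n"
    by (simp add: triple_power fps_numeral_fps_const)
qed

section \<open>The operators on polynomials in the Hauptmodul\<close>

text \<open>The coefficient of x^i in (1 + x + x^2)^m, given by a recursion that can be evaluated
  for the values needed at m = 1 and m = 6.\<close>

fun trinomial :: "nat \<Rightarrow> nat \<Rightarrow> int" where
  "trinomial 0 i = (if i = 0 then 1 else 0)"
| "trinomial (Suc m) i = trinomial m i + (if i \<ge> 1 then trinomial m (i - 1) else 0)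
    + (if i \<ge> 2 then trinomial m (i - 2) else 0)"

lemma trinomial_eq_0: "i > 2 * m \<Longrightarrow> trinomial m i = 0"
  by (induction m arbitrary: i) auto

lemma trinomial_power:
  fixes x y :: "'a::comm_ring_1"
  shows "(x ^ 2 + x * y + y ^ 2) ^ m = (\<Sum>i\<le>2 * m. of_int (trinomial m i) * x ^ (2 * m - i) * y ^ i)"
proof (induction m)
  case (Suc m)
  define c where "c i = (of_int (trinomial m i) :: 'a)" for i
  have c0: "c i = 0" if "i > 2 * m" for i
    using that by (simp add: c_def trinomial_eq_0)
  have 0: "(\<Sum>i\<le>2 * Suc m. c i * x ^ (2 * Suc m - i) * y ^ i)
      = x ^ 2 * (\<Sum>i\<le>2 * m. c i * x ^ (2 * m - i) * y ^ i)"
  proof -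
    have "x ^ (2 * Suc m - i) = x ^ 2 * x ^ (2 * m - i)" if "i \<le> 2 * m" for i
      using that by (simp add: Suc_diff_le power2_eq_square mult.assoc)
    then show ?thesis
      by (simp add: c0 sum_distrib_left mult_ac)
  qed
  have 1: "(\<Sum>i\<le>2 * Suc m. (if i \<ge> 1 then c (i - 1) else 0) * x ^ (2 * Suc m - i) * y ^ i)
      = x * y * (\<Sum>i\<le>2 * m. c i * x ^ (2 * m - i) * y ^ i)"
  proof -
    have "2 * Suc m = Suc (Suc (2 * m))" by simp
    then show ?thesis
      unfolding sum_distrib_left
      by (simp only: sum.atMost_Suc_shift[of _ "Suc (2 * m)"])
         (simp add: c0 Suc_diff_le mult_ac)
  qed
  have 2: "(\<Sum>i\<le>2 * Suc m. (if i \<ge> 2 then c (i - 2) else 0) * x ^ (2 * Suc m - i) * y ^ i)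
      = y ^ 2 * (\<Sum>i\<le>2 * m. c i * x ^ (2 * m - i) * y ^ i)"
    by (simp add: sum_distrib_left mult_ac sum.atMost_Suc_shift power2_eq_square del: sum.atMost_Suc)
  have "(x ^ 2 + x * y + y ^ 2) ^ Suc m = (\<Sum>i\<le>2 * Suc m. c i * x ^ (2 * Suc m - i) * y ^ i)
      + (\<Sum>i\<le>2 * Suc m. (if i \<ge> 1 then c (i - 1) else 0) * x ^ (2 * Suc m - i) * y ^ i)
      + (\<Sum>i\<le>2 * Suc m. (if i \<ge> 2 then c (i - 2) else 0) * x ^ (2 * Suc m - i) * y ^ i)"
    unfolding 0 1 2 power_Suc Suc.IH[folded c_def] by (simp only: distrib_right)
  also have "\<dots> = (\<Sum>i\<le>2 * Suc m. of_int (trinomial (Suc m) i) * x ^ (2 * Suc m - i) * y ^ i)"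
    unfolding sum.distrib[symmetric] by (intro sum.cong) (auto simp: c_def distrib_right)
  finally show ?case .
qed simp

section \<open>The reciprocal of E(q)^3 as a quadratic form over series in q^3\<close>

abbreviation E :: "int fps" where "E \<equiv> euler"
abbreviation F :: "int fps" where "F \<equiv> triple euler"

definition E_inv :: "int fps" where "E_inv = fps_right_inverse E 1"
definition F_inv :: "int fps" where "F_inv = triple E_inv"
text \<open>The series A of the overview, with q^3 replaced by q.\<close>

definition cube_part :: "int fps" where "cube_part = trisect 0 (E ^ 3)"
text \<open>The series T of the overview: 27 (eta(3 tau) / eta(tau))^12, a Hauptmodul for
  Gamma_0(3). The factor 27 makes \<open>cube_part ^ 3\<close> a multiple of 1 + T.\<close>

definition haupt :: "int fps" where "haupt = 27 * (fps_X * F ^ 12 * E_inv ^ 12)"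

lemma E_mult_inv: "E * E_inv = 1"
  unfolding E_inv_def by (rule fps_right_inverse) simp

lemma F_mult_inv: "F * F_inv = 1"
  unfolding F_inv_def by (simp flip: triple_mult add: E_mult_inv)

lemma monomial_cancel: "E ^ p * F ^ (s + d) * E_inv ^ (p + t) * F_inv ^ d = F ^ s * E_inv ^ t"
proof -
  have "E ^ p * F ^ (s + d) * E_inv ^ (p + t) * F_inv ^ d
      = (E * E_inv) ^ p * (F * F_inv) ^ d * (F ^ s * E_inv ^ t)"
    unfolding power_mult_distrib power_add by (simp only: mult_ac)
  then show ?thesis
    by (simp add: E_mult_inv F_mult_inv)
qed

lemma E_cube: "E ^ 3 = triple cube_part - 3 * fps_X * triple (F ^ 3)"
  using trisection[of "E ^ 3"]
  by (simp add: cube_part_def trisect_1_euler_cube[simplified] trisect_2_euler_cube triple_mult triple_power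
      fps_compose_uminus algebra_simps)

text \<open>The norm of E^3 computed twice: from its trisection, whose residue-2 part vanishes
  together with the mixed term, and from \<open>cubic_norm_euler\<close> by
  multiplicativity.\<close>

lemma cube_part_norm: "(cube_part ^ 3 - 27 * fps_X * F ^ 9) * F ^ 3 = E ^ 12"
proof -
  have "cubic_norm (E ^ 3) = cube_part ^ 3 - 27 * fps_X * F ^ 9"
    unfolding cubic_norm_def trisect_1_euler_cube trisect_2_euler_cube cube_part_def[symmetric]
    by (simp add: power_mult_distrib flip: power_mult)
  moreover have "cubic_norm (E ^ 3) * F ^ 3 = (cubic_norm E * F) ^ 3"
    by (simp add: cubic_norm_power power_mult_distrib)
  moreover have "\<dots> = E ^ 12"
    unfolding cubic_norm_euler by (simp flip: power_mult)
  ultimately show ?thesis by simp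
qed

lemma cube_part_cube: "cube_part ^ 3 = E ^ 12 * F_inv ^ 3 * (1 + haupt)"
proof -
  have "cube_part ^ 3 * (F * F_inv) ^ 3 = (cube_part ^ 3 - 27 * fps_X * F ^ 9) * F ^ 3 * F_inv ^ 3
      + 27 * fps_X * F ^ 9 * (F * F_inv) ^ 3"
    by (simp add: algebra_simps)
  also have "\<dots> = E ^ 12 * F_inv ^ 3 + 27 * fps_X * (E ^ 12 * F ^ (9 + 3) * E_inv ^ (12 + 0) * F_inv ^ 3)"
    unfolding cube_part_norm monomial_cancel by (simp add: F_mult_inv)
  also have "\<dots> = E ^ 12 * F_inv ^ 3 * (1 + haupt)"
    by (simp add: haupt_def algebra_simps)
  finally show ?thesis
    by (simp add: F_mult_inv)
qed

text \<open>With E^3 = a - b, the reciprocal is (a^2 + a b + b^2) / (a^3 - b^3). The denominator is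
  a series in q^3, and \<open>cube_part_norm\<close> supplies its inverse.\<close>

lemma E_inv_cube:
  "E_inv ^ 3 = (triple cube_part ^ 2 + triple cube_part * (3 * fps_X * triple (F ^ 3)) + (3 * fps_X * triple (F ^ 3)) ^ 2)
    * triple (F ^ 3 * E_inv ^ 12)"
proof -
  define W where "W = triple cube_part ^ 2 + triple cube_part * (3 * fps_X * triple (F ^ 3)) + (3 * fps_X * triple (F ^ 3)) ^ 2"
  have "E ^ 3 * W = triple cube_part ^ 3 - (3 * fps_X * triple (F ^ 3)) ^ 3"
    unfolding E_cube W_def by (simp add: algebra_simps power2_eq_square power3_eq_cube)
  also have "\<dots> = triple (cube_part ^ 3 - 27 * fps_X * F ^ 9)"
    by (simp add: triple_power triple_mult fps_compose_sub_distrib power_mult_distrib flip: power_mult)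
  finally have "E ^ 3 * W * triple (F ^ 3 * E_inv ^ 12)
      = triple ((cube_part ^ 3 - 27 * fps_X * F ^ 9) * F ^ 3 * E_inv ^ 12)"
    by (simp only: triple_mult mult.assoc)
  also have "\<dots> = triple ((E * E_inv) ^ 12)"
    unfolding cube_part_norm power_mult_distrib ..
  finally have W: "E ^ 3 * (W * triple (F ^ 3 * E_inv ^ 12)) = 1"
    by (simp add: E_mult_inv mult.assoc)
  have "E_inv ^ 3 = E_inv ^ 3 * (E ^ 3 * (W * triple (F ^ 3 * E_inv ^ 12)))"
    unfolding W by simp
  also have "\<dots> = (E * E_inv) ^ 3 * (W * triple (F ^ 3 * E_inv ^ 12))"
    unfolding power_mult_distrib by (simp only: mult_ac)
  finally show ?thesis
    by (simp add: E_mult_inv W_def)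
qed

text \<open>The m-th power of \<open>E_inv_cube\<close> expands by \<open>trinomial_power\<close>.
  Term i is \<open>fps_X ^ (i + j)\<close> times a series in q^3 and carries \<open>3 ^ i\<close>,
  so the residue class selects the indices i.\<close>

lemma trisect_monomial:
  assumes "r < 3"
  shows "trisect r (fps_X ^ j * triple u * E_inv ^ (3 * m)) =
    (\<Sum>i | i \<le> 2 * m \<and> (i + j) mod 3 = r. fps_const (trinomial m i * 3 ^ i)
      * (fps_X ^ ((i + j) div 3) * (u * F ^ (3 * m + 3 * i) * E_inv ^ (12 * m) * cube_part ^ (2 * m - i))))"
proof -
  define v where "v i = u * F ^ (3 * m + 3 * i) * E_inv ^ (12 * m) * cube_part ^ (2 * m - i)" for i
  have "fps_X ^ j * triple u * E_inv ^ (3 * m)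
    = fps_X ^ j * triple u * ((\<Sum>i\<le>2 * m. of_int (trinomial m i) * triple cube_part ^ (2 * m - i)
        * (3 * fps_X * triple (F ^ 3)) ^ i) * triple (F ^ 3 * E_inv ^ 12) ^ m)"
    unfolding power_mult E_inv_cube power_mult_distrib[of "_ + _"] trinomial_power ..
  also have "\<dots> = (\<Sum>i\<le>2 * m. fps_const (trinomial m i * 3 ^ i) * (fps_X ^ (i + j) * triple (v i)))"
  proof -
    have "fps_X ^ j * triple u * (of_int (trinomial m i) * triple cube_part ^ (2 * m - i)
          * (3 * fps_X * triple (F ^ 3)) ^ i * triple (F ^ 3 * E_inv ^ 12) ^ m)
        = fps_const (trinomial m i * 3 ^ i) * (fps_X ^ (i + j) * triple (v i))" for i
    proof -
      have "v i = u * cube_part ^ (2 * m - i) * (F ^ 3) ^ i * (F ^ 3 * E_inv ^ 12) ^ m"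
        unfolding v_def power_mult_distrib power_add power_mult by (simp only: mult_ac)
      then have "triple (v i) = triple u * triple cube_part ^ (2 * m - i) * triple (F ^ 3) ^ i
          * triple (F ^ 3 * E_inv ^ 12) ^ m"
        by (simp only: triple_mult triple_power)
      moreover have "fps_const (trinomial m i) = of_int (trinomial m i)"
        using fps_of_int[of "trinomial m i", where 'a = int] by simp
      then have "fps_const (trinomial m i * 3 ^ i) = of_int (trinomial m i) * 3 ^ i"
        by (simp only: fps_numeral_fps_const flip: fps_const_mult fps_const_power)
      ultimately show ?thesis
        by (simp only: power_mult_distrib power_add mult_ac)
    qed
    then show ?thesis
      by (simp only: sum_distrib_left sum_distrib_right)
  qed
  finally have "trisect r (fps_X ^ j * triple u * E_inv ^ (3 * m)) = (\<Sum>i\<le>2 * m.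
      if (i + j) mod 3 = r then fps_const (trinomial m i * 3 ^ i) * (fps_X ^ ((i + j) div 3) * v i) else 0)"
    using assms by (simp only: trisect_sum trisect_const_mult trisect_X_power_triple if_distrib[of "(*) _"] mult_zero_right)
  also have "\<dots> = (\<Sum>i | i \<le> 2 * m \<and> (i + j) mod 3 = r.
      fps_const (trinomial m i * 3 ^ i) * (fps_X ^ ((i + j) div 3) * v i))"
    by (simp only: sum.inter_filter[symmetric] finite_atMost) simp
  finally show ?thesis
    unfolding v_def .
qed

section \<open>The modules over integer polynomials in the Hauptmodul\<close>

text \<open>The ring of integer polynomials in T, generated monomial by monomial so that statements
  about the additive operators \<open>trisect r\<close> reduce to powers of T.\<close>

inductive_set polys_haupt :: "int fps set" where
  zero: "0 \<in> polys_haupt"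
| add_monomial: "p \<in> polys_haupt \<Longrightarrow> fps_const c * haupt ^ j + p \<in> polys_haupt"

lemma polys_haupt_add: "p \<in> polys_haupt \<Longrightarrow> q \<in> polys_haupt \<Longrightarrow> p + q \<in> polys_haupt"
  by (induction p rule: polys_haupt.induct) (auto simp: add.assoc intro: polys_haupt.intros)

lemma polys_haupt_const_mult: "p \<in> polys_haupt \<Longrightarrow> fps_const b * p \<in> polys_haupt"
proof (induction p rule: polys_haupt.induct)
  case (add_monomial p c j)
  then show ?case
    using polys_haupt.add_monomial[of "fps_const b * p" "b * c" j]
    by (simp add: distrib_left flip: mult.assoc)
qed (auto intro: polys_haupt.zero)

lemma polys_haupt_haupt_mult: "p \<in> polys_haupt \<Longrightarrow> haupt * p \<in> polys_haupt"
proof (induction p rule: polys_haupt.induct)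
  case (add_monomial p c j)
  then show ?case
    using polys_haupt.add_monomial[of "haupt * p" c "Suc j"] by (simp add: distrib_left mult_ac)
qed (auto intro: polys_haupt.zero)

lemma polys_haupt_one: "1 \<in> polys_haupt"
  using polys_haupt.add_monomial[OF polys_haupt.zero, of 1 0] by simp

lemma polys_haupt_monomial: "haupt ^ l * (1 + haupt) ^ d \<in> polys_haupt"
proof -
  have "(1 + haupt) ^ d \<in> polys_haupt"
    by (induction d) (auto simp: distrib_right intro: polys_haupt_one polys_haupt_add polys_haupt_haupt_mult)
  then show ?thesis
    by (induction l) (auto simp: mult.assoc intro: polys_haupt_haupt_mult)
qed

lemma polys_haupt_sum: "(\<And>i. i \<in> A \<Longrightarrow> p i \<in> polys_haupt) \<Longrightarrow> (\<Sum>i\<in>A. p i) \<in> polys_haupt"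
  by (induction A rule: infinite_finite_induct) (auto intro: polys_haupt.zero polys_haupt_add)

text \<open>The module generators; odd and even refer to the exponent of 3 in the modulus of the
  progression.\<close>

definition g_odd :: "int fps" where "g_odd = F ^ 6 * E_inv ^ 12"
definition g_even :: "int fps" where "g_even = F ^ 12 * E_inv ^ 18"

lemma haupt_power: "haupt ^ j = fps_const (27 ^ j) * (fps_X ^ j * F ^ (12 * j) * E_inv ^ (12 * j))"
proof -
  have "fps_const (27 ^ j :: int) = 27 ^ j"
    by (simp only: fps_numeral_fps_const flip: fps_const_power)
  then show ?thesis
    unfolding haupt_def power_mult_distrib power_mult by (simp only: mult.assoc)
qed

text \<open>Puts the product into the form treated by \<open>trisect_monomial\<close>, with m = 4j +
  4.\<close>

lemma g_odd_haupt_power: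
  "g_odd * haupt ^ j = fps_const (27 ^ j) * (fps_X ^ j * triple (E ^ (6 + 12 * j)) * E_inv ^ (3 * (4 * j + 4)))"
proof -
  have "3 * (4 * j + 4) = 12 + 12 * j" by simp
  then show ?thesis
    unfolding haupt_power g_odd_def triple_power by (simp only: power_add mult_ac)
qed

lemma g_even_haupt_power:
  "g_even * haupt ^ j = fps_const (27 ^ j) * (fps_X ^ j * triple (E ^ (12 + 12 * j)) * E_inv ^ (3 * (4 * j + 6)))"
proof -
  have "3 * (4 * j + 6) = 18 + 12 * j" by simp
  then show ?thesis
    unfolding haupt_power g_even_def triple_power by (simp only: power_add mult_ac)
qed

text \<open>Turns one term of \<open>trisect_monomial\<close> into an element of the target module.
  Since 3 divides k, the power of \<open>cube_part\<close> becomes a power of 1 + T, and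
  \<open>fps_X ^ l\<close> with \<open>27 ^ l\<close> becomes part of T^l. The other hypotheses
  balance the powers of 3, of E and of F.\<close>

lemma monomial_reduce:
  assumes "k = 3 * d" "z * 3 ^ i = b * 27 ^ l" "p + 12 * d + t + 12 * l = 12 * m"
    "s + 12 * l + 3 * d = 3 * m + 3 * i"
  shows "fps_const z * (fps_const (c * 3 ^ i) * (fps_X ^ l * (E ^ p * F ^ (3 * m + 3 * i) * E_inv ^ (12 * m) * cube_part ^ k)))
    = F ^ s * E_inv ^ t * (fps_const (b * c) * (haupt ^ l * (1 + haupt) ^ d))"
proof -
  have "cube_part ^ k = E ^ (12 * d) * F_inv ^ (3 * d) * (1 + haupt) ^ d"
    unfolding assms(1) power_mult cube_part_cube by (simp only: power_mult_distrib)
  then have "E ^ p * F ^ (3 * m + 3 * i) * E_inv ^ (12 * m) * cube_part ^ k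
      = (E ^ (p + 12 * d) * F ^ (s + 12 * l + 3 * d) * E_inv ^ (p + 12 * d + (t + 12 * l)) * F_inv ^ (3 * d))
        * (1 + haupt) ^ d"
    unfolding assms(3,4)[symmetric] by (simp only: power_add mult_ac)
  also have "\<dots> = F ^ s * E_inv ^ t * (F ^ (12 * l) * E_inv ^ (12 * l)) * (1 + haupt) ^ d"
    unfolding monomial_cancel by (simp only: power_add mult_ac)
  finally have 1: "E ^ p * F ^ (3 * m + 3 * i) * E_inv ^ (12 * m) * cube_part ^ k
      = F ^ s * E_inv ^ t * (F ^ (12 * l) * E_inv ^ (12 * l)) * (1 + haupt) ^ d" .
  have z: "z * (c * 3 ^ i) = b * c * 27 ^ l"
    using assms(2) by (simp add: mult_ac)
  then have 2: "fps_const z * fps_const (c * 3 ^ i) = fps_const (b * c) * fps_const (27 ^ l)"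
    by (simp only: fps_const_mult z)
  have "fps_const z * (fps_const (c * 3 ^ i) * (fps_X ^ l * (E ^ p * F ^ (3 * m + 3 * i) * E_inv ^ (12 * m) * cube_part ^ k)))
    = (fps_const z * fps_const (c * 3 ^ i)) * (fps_X ^ l * (F ^ s * E_inv ^ t * (F ^ (12 * l) * E_inv ^ (12 * l)) * (1 + haupt) ^ d))"
    unfolding 1 by (simp only: mult.assoc)
  also have "\<dots> = F ^ s * E_inv ^ t * (fps_const (b * c) * (haupt ^ l * (1 + haupt) ^ d))"
    unfolding 2 haupt_power by (simp only: mult_ac)
  finally show ?thesis .
qed

lemma trisect_2_g_odd_haupt_power: "\<exists>p\<in>polys_haupt. trisect 2 (g_odd * haupt ^ j) = 9 * g_even * p"
proof
  \<comment> \<open>With m = 4j + 4 and i + j = 3l + 2, the exponent 2m - i of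
    \<open>cube_part\<close> is 3 (3j + 2 - l).\<close>
  define p where "p = (\<Sum>i | i \<le> 2 * (4 * j + 4) \<and> (i + j) mod 3 = 2. fps_const (9 ^ j * trinomial (4 * j + 4) i)
      * (haupt ^ ((i + j) div 3) * (1 + haupt) ^ (3 * j + 2 - (i + j) div 3)))"
  show "p \<in> polys_haupt"
    unfolding p_def by (intro polys_haupt_sum polys_haupt_const_mult polys_haupt_monomial)
  have nine: "9 * g_even * (fps_const (9 ^ j * c) * q) = F ^ 12 * E_inv ^ 18 * (fps_const (9 * 9 ^ j * c) * q)" for c q
  proof -
    have "fps_const (9 * 9 ^ j * c) = 9 * fps_const (9 ^ j * c)"
      by (simp only: fps_numeral_fps_const fps_const_mult mult.assoc)
    then show ?thesis
      unfolding g_even_def by (simp only: mult_ac)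
  qed
  show "trisect 2 (g_odd * haupt ^ j) = 9 * g_even * p"
    unfolding g_odd_haupt_power trisect_const_mult trisect_monomial[of 2, simplified] p_def sum_distrib_left nine
  proof (rule sum.cong)
    fix i assume "i \<in> {i. i \<le> 2 * (4 * j + 4) \<and> (i + j) mod 3 = 2}"
    then have i: "i \<le> 8 * j + 8" "(i + j) mod 3 = 2" by simp_all
    define l where "l = (i + j) div 3"
    have l: "i + j = 3 * l + 2"
      using i(2) by (simp add: l_def) presburger
    then have "i + 3 * j = 2 * (j + 1) + 3 * l" "l \<le> 3 * j + 2" using i(1) by simp_all
    \<comment> \<open>Residue 2 makes i = 3l + 2 - j, so the total exponent of 3 is 2j + 2 + 3l;
      this is the origin of the extra factor 9.\<close>
    then have "(3::int) ^ (3 * j) * 3 ^ i = 3 ^ (2 * (j + 1)) * 3 ^ (3 * l)"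
      by (simp only: add.commute flip: power_add)
    then have "(27::int) ^ j * 3 ^ i = 9 * 9 ^ j * 27 ^ l"
      by (simp add: power_mult)
    then show "fps_const (27 ^ j) * (fps_const (trinomial (4 * j + 4) i * 3 ^ i) * (fps_X ^ ((i + j) div 3)
        * (E ^ (6 + 12 * j) * F ^ (3 * (4 * j + 4) + 3 * i) * E_inv ^ (12 * (4 * j + 4)) * cube_part ^ (2 * (4 * j + 4) - i))))
      = F ^ 12 * E_inv ^ 18 * (fps_const (9 * 9 ^ j * trinomial (4 * j + 4) i)
        * (haupt ^ ((i + j) div 3) * (1 + haupt) ^ (3 * j + 2 - (i + j) div 3)))"
      unfolding l_def[symmetric] using l \<open>l \<le> 3 * j + 2\<close> i(1)
      by (intro monomial_reduce) auto
  qed simp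
qed

lemma trisect_0_g_even_haupt_power: "\<exists>p\<in>polys_haupt. trisect 0 (g_even * haupt ^ j) = g_odd * p"
proof
  \<comment> \<open>Here m = 4j + 6 and i + j = 3l, so 2m - i = 3 (3j + 4 - l). The total exponent
    of 3 is 2j + 3l, which leaves no constant gain.\<close>
  define p where "p = (\<Sum>i | i \<le> 2 * (4 * j + 6) \<and> (i + j) mod 3 = 0. fps_const (9 ^ j * trinomial (4 * j + 6) i)
      * (haupt ^ ((i + j) div 3) * (1 + haupt) ^ (3 * j + 4 - (i + j) div 3)))"
  show "p \<in> polys_haupt"
    unfolding p_def by (intro polys_haupt_sum polys_haupt_const_mult polys_haupt_monomial)
  show "trisect 0 (g_even * haupt ^ j) = g_odd * p"
    unfolding g_even_haupt_power trisect_const_mult trisect_monomial[of 0, simplified] p_def sum_distrib_left g_odd_def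
  proof (rule sum.cong)
    fix i assume "i \<in> {i. i \<le> 2 * (4 * j + 6) \<and> (i + j) mod 3 = 0}"
    then have i: "i \<le> 8 * j + 12" "(i + j) mod 3 = 0" by simp_all
    define l where "l = (i + j) div 3"
    have l: "i + j = 3 * l"
      using i(2) unfolding l_def by presburger
    then have "i + 3 * j = 2 * j + 3 * l" "l \<le> 3 * j + 4" using i(1) by simp_all
    then have "(3::int) ^ (3 * j) * 3 ^ i = 3 ^ (2 * j) * 3 ^ (3 * l)"
      by (simp only: add.commute flip: power_add)
    then have "(27::int) ^ j * 3 ^ i = 9 ^ j * 27 ^ l"
      by (simp add: power_mult)
    then show "fps_const (27 ^ j) * (fps_const (trinomial (4 * j + 6) i * 3 ^ i) * (fps_X ^ ((i + j) div 3)
        * (E ^ (12 + 12 * j) * F ^ (3 * (4 * j + 6) + 3 * i) * E_inv ^ (12 * (4 * j + 6)) * cube_part ^ (2 * (4 * j + 6) - i))))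
      = F ^ 6 * E_inv ^ 12 * (fps_const (9 ^ j * trinomial (4 * j + 6) i)
        * (haupt ^ ((i + j) div 3) * (1 + haupt) ^ (3 * j + 4 - (i + j) div 3)))"
      unfolding l_def[symmetric] using l \<open>l \<le> 3 * j + 4\<close> i(1)
      by (intro monomial_reduce) auto
  qed simp
qed

lemma trisect_2_g_odd: "p \<in> polys_haupt \<Longrightarrow> \<exists>q\<in>polys_haupt. trisect 2 (g_odd * p) = 9 * g_even * q"
proof (induction p rule: polys_haupt.induct)
  case zero
  show ?case by (intro bexI[of _ 0]) (auto intro: polys_haupt.zero)
next
  case (add_monomial p c j)
  obtain q where q: "q \<in> polys_haupt" "trisect 2 (g_odd * p) = 9 * g_even * q"
    using add_monomial.IH by blast
  obtain q' where q': "q' \<in> polys_haupt" "trisect 2 (g_odd * haupt ^ j) = 9 * g_even * q'"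
    using trisect_2_g_odd_haupt_power by blast
  have "g_odd * (fps_const c * haupt ^ j + p) = fps_const c * (g_odd * haupt ^ j) + g_odd * p"
    by (simp add: algebra_simps)
  then have "trisect 2 (g_odd * (fps_const c * haupt ^ j + p)) = fps_const c * (9 * g_even * q') + 9 * g_even * q"
    by (simp only: trisect_add trisect_const_mult q q')
  also have "\<dots> = 9 * g_even * (fps_const c * q' + q)"
    by (simp add: algebra_simps)
  finally have "trisect 2 (g_odd * (fps_const c * haupt ^ j + p)) = 9 * g_even * (fps_const c * q' + q)" .
  then show ?case
    using q q' polys_haupt_add polys_haupt_const_mult by blast
qed

lemma trisect_0_g_even: "p \<in> polys_haupt \<Longrightarrow> \<exists>q\<in>polys_haupt. trisect 0 (g_even * p) = g_odd * q"
proof (induction p rule: polys_haupt.induct)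
  case zero
  show ?case by (intro bexI[of _ 0]) (auto intro: polys_haupt.zero)
next
  case (add_monomial p c j)
  obtain q where q: "q \<in> polys_haupt" "trisect 0 (g_even * p) = g_odd * q"
    using add_monomial.IH by blast
  obtain q' where q': "q' \<in> polys_haupt" "trisect 0 (g_even * haupt ^ j) = g_odd * q'"
    using trisect_0_g_even_haupt_power by blast
  have "g_even * (fps_const c * haupt ^ j + p) = fps_const c * (g_even * haupt ^ j) + g_even * p"
    by (simp add: algebra_simps)
  then have "trisect 0 (g_even * (fps_const c * haupt ^ j + p)) = fps_const c * (g_odd * q') + g_odd * q"
    by (simp only: trisect_add trisect_const_mult q q')
  also have "\<dots> = g_odd * (fps_const c * q' + q)"
    by (simp add: algebra_simps)
  finally have "trisect 0 (g_even * (fps_const c * haupt ^ j + p)) = g_odd * (fps_const c * q' + q)" .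
  then show ?case
    using q q' polys_haupt_add polys_haupt_const_mult by blast
qed

section \<open>Extra powers of 3 in the remaining residue classes\<close>

lemma trisect_monomial_dvd:
  assumes "r < 3" "\<And>i. (i + j) mod 3 = r \<Longrightarrow> d dvd z * (trinomial m i * 3 ^ i)"
  shows "fps_const d dvd trisect r (fps_const z * (fps_X ^ j * triple u * E_inv ^ (3 * m)))"
  unfolding trisect_const_mult trisect_monomial[OF assms(1)] sum_distrib_left
proof (rule dvd_sum)
  fix i assume "i \<in> {i. i \<le> 2 * m \<and> (i + j) mod 3 = r}"
  then obtain k where k: "z * (trinomial m i * 3 ^ i) = d * k"
    using assms(2) by (auto elim: dvdE)
  have "fps_const z * fps_const (trinomial m i * 3 ^ i) = fps_const d * fps_const k"
    by (simp only: fps_const_mult k)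
  then have "fps_const z * (fps_const (trinomial m i * 3 ^ i) * f) = fps_const d * (fps_const k * f)" for f
    by (simp only: flip: mult.assoc)
  then show "fps_const d dvd fps_const z * (fps_const (trinomial m i * 3 ^ i) * (fps_X ^ ((i + j) div 3)
      * (u * F ^ (3 * m + 3 * i) * E_inv ^ (12 * m) * cube_part ^ (2 * m - i))))"
    by (simp only: dvd_triv_left)
qed

lemma trisect_polys_haupt_dvd:
  assumes "\<And>j. fps_const d dvd trisect r (g * haupt ^ j)" "p \<in> polys_haupt"
  shows "fps_const d dvd trisect r (g * p)"
  using assms(2)
proof (induction p rule: polys_haupt.induct)
  case (add_monomial p c j)
  have "trisect r (g * (fps_const c * haupt ^ j + p)) = fps_const c * trisect r (g * haupt ^ j) + trisect r (g * p)"
    by (simp add: algebra_simps trisect_add flip: trisect_const_mult)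
  then show ?case
    using add_monomial.IH assms(1) by (simp only: dvd_add dvd_mult)
qed simp

text \<open>For j > 0 the factor \<open>27 ^ j\<close> suffices; for j = 0 the residue condition
  forces i > 0, so \<open>3 ^ i\<close> does.\<close>

lemma trisect_1_g_odd_dvd:
  assumes "p \<in> polys_haupt"
  shows "fps_const 3 dvd trisect 1 (g_odd * p)"
proof (rule trisect_polys_haupt_dvd[OF _ assms])
  fix j
  have "(3::int) dvd 27 ^ j * (trinomial (4 * j + 4) i * 3 ^ i)" if "(i + j) mod 3 = 1" for i
  proof (cases "j = 0")
    case True
    then have "i \<noteq> 0" using that by auto
    then show ?thesis by (auto intro!: dvd_mult)
  next
    case False
    then have "(27::int) dvd 27 ^ j" by simp
    then have "(3::int) dvd 27 ^ j" by (rule dvd_trans[rotated]) simp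
    then show ?thesis by (rule dvd_mult2)
  qed
  then show "fps_const 3 dvd trisect 1 (g_odd * haupt ^ j)"
    unfolding g_odd_haupt_power by (intro trisect_monomial_dvd) simp_all
qed

text \<open>Only j = 0 is critical, where m = 6. The smallest indices give 6 * 3 = 18 for residue 1
  and 21 * 9 = 189 = 7 * 27 for residue 2; every i \<ge> 3 already gives 27.\<close>

lemma trisect_g_even_dvd:
  assumes "p \<in> polys_haupt"
  shows "fps_const 9 dvd trisect 1 (g_even * p)" "fps_const 27 dvd trisect 2 (g_even * p)"
proof -
  have *: "(27::int) dvd 27 ^ j * (trinomial (4 * j + 6) i * 3 ^ i)"
    if "j = 0 \<Longrightarrow> (27::int) dvd trinomial 6 i * 3 ^ i" for i j
    using that by (cases "j = 0") (auto intro!: dvd_mult2)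
  have tri: "trinomial 6 1 = 6" "trinomial 6 2 = 21"
    by (simp_all add: eval_nat_numeral)
  have power: "(27::int) dvd 3 ^ i" if "i \<ge> 3" for i
    using le_imp_power_dvd[OF that, of "3::int"] by simp
  have "(9::int) dvd trinomial 6 i * 3 ^ i" if "i mod 3 = 1" for i
  proof (cases "i = 1")
    case False
    with that have "i \<ge> 3" by presburger
    then have "(9::int) dvd 3 ^ i" by (intro dvd_trans[OF _ power]) simp_all
    then show ?thesis by (rule dvd_mult)
  qed (simp add: tri[simplified])
  moreover have "(9::int) dvd 27 ^ j" if "j \<noteq> 0" for j
  proof (rule dvd_trans)
    show "(9::int) dvd 27" "(27::int) dvd 27 ^ j" using that by simp_all
  qed
  ultimately have dvd_9: "(9::int) dvd 27 ^ j * (trinomial (4 * j + 6) i * 3 ^ i)" if "(i + j) mod 3 = 1" for i j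
    using that by (cases "j = 0") (auto intro!: dvd_mult2)
  show "fps_const 9 dvd trisect 1 (g_even * p)"
    by (rule trisect_polys_haupt_dvd[OF _ assms]) (unfold g_even_haupt_power, rule trisect_monomial_dvd, simp, erule dvd_9)
  have "(27::int) dvd trinomial 6 i * 3 ^ i" if "i mod 3 = 2" for i
  proof (cases "i = 2")
    case False
    with that have "i \<ge> 3" by presburger
    then show ?thesis by (intro dvd_mult power)
  qed (simp add: tri)
  then have dvd_27: "(27::int) dvd 27 ^ j * (trinomial (4 * j + 6) i * 3 ^ i)" if "(i + j) mod 3 = 2" for i j
    using that by (intro *) simp
  show "fps_const 27 dvd trisect 2 (g_even * p)"
    by (rule trisect_polys_haupt_dvd[OF _ assms]) (unfold g_even_haupt_power, rule trisect_monomial_dvd, simp, erule dvd_27)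
qed

section \<open>The congruences\<close>

lemma p93_eq: "Abs_fps p93 = E_inv ^ 3 * triple (F_inv ^ 3)"
proof -
  have "p93_denominator = E ^ 3 * triple (F ^ 3)"
    unfolding p93_denominator_def qpoch_inf_X_power[of 9, simplified] triple_power triple_triple
    by (simp add: euler_def)
  moreover have "E ^ 3 * triple (F ^ 3) * (E_inv ^ 3 * triple (F_inv ^ 3)) = (E * E_inv) ^ 3 * triple ((F * F_inv) ^ 3)"
    by (simp only: power_mult_distrib triple_mult mult_ac)
  moreover have "\<dots> = 1"
    by (simp add: E_mult_inv F_mult_inv)
  ultimately have "p93_denominator * Abs_fps (fps_nth (E_inv ^ 3 * triple (F_inv ^ 3))) = 1"
    by (simp add: fps_nth_inverse)
  then have "fps_nth (E_inv ^ 3 * triple (F_inv ^ 3)) = p93"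
    by (rule p93_unique)
  then show ?thesis
    by (metis fps_nth_inverse)
qed

text \<open>The factor 1 / E(q^9)^3 is a series in q^3 and splits off. For m = 1 only i = 2
  contributes, with \<open>3 ^ 2\<close> and without \<open>cube_part\<close>.\<close>

lemma trisect_2_p93: "trisect 2 (Abs_fps p93) = 9 * g_odd"
proof -
  have "{i. i \<le> 2 * 1 \<and> (i + 0) mod 3 = (2::nat)} = {2}"
    by (auto simp: le_Suc_eq numeral_2_eq_2)
  moreover have "trinomial 1 2 = 1"
    by (simp add: eval_nat_numeral)
  ultimately have "trisect 2 (fps_X ^ 0 * triple 1 * E_inv ^ (3 * 1)) = fps_const 9 * (F ^ 9 * E_inv ^ 12)"
    by (subst trisect_monomial) simp_all
  then have "trisect 2 (Abs_fps p93) = 9 * (F ^ 9 * E_inv ^ 12) * F_inv ^ 3"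
    unfolding p93_eq by (subst trisect_mult_triple) (simp_all add: fps_numeral_fps_const)
  also have "\<dots> = 9 * (E ^ 0 * F ^ (6 + 3) * E_inv ^ (0 + 12) * F_inv ^ 3)"
    by (simp add: mult.assoc)
  also have "\<dots> = 9 * g_odd"
    unfolding monomial_cancel g_odd_def ..
  finally show ?thesis .
qed

definition p93_series :: "nat \<Rightarrow> nat \<Rightarrow> int fps"
  where "p93_series m s = Abs_fps (\<lambda>n. p93 (m * n + s))"

lemma trisect_p93_series: "trisect r (p93_series m s) = p93_series (3 * m) (m * r + s)"
  by (rule fps_ext) (simp add: p93_series_def algebra_simps)

text \<open>Residue 2 leads from an odd to an even power of 3 and gains 9 by
  \<open>trisect_2_g_odd\<close>; residue 0 leads to the next odd power, keeping both the offset and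
  the power of 3 already gained.\<close>

lemma p93_series_odd_even:
  "\<exists>p\<in>polys_haupt. p93_series (3 ^ (2 * k + 1)) ((3 ^ (2 * k + 1) + 5) div 4)
     = fps_const (3 ^ (2 * k + 2)) * (g_odd * p)"
  "\<exists>p\<in>polys_haupt. p93_series (3 ^ (2 * k + 2)) ((3 ^ (2 * k + 3) + 5) div 4)
     = fps_const (3 ^ (2 * k + 4)) * (g_even * p)"
proof -
  have even: "\<exists>p\<in>polys_haupt. p93_series (3 ^ (2 * k + 2)) ((3 ^ (2 * k + 3) + 5) div 4)
      = fps_const (3 ^ (2 * k + 4)) * (g_even * p)"
    if odd: "\<exists>p\<in>polys_haupt. p93_series (3 ^ (2 * k + 1)) ((3 ^ (2 * k + 1) + 5) div 4)
      = fps_const (3 ^ (2 * k + 2)) * (g_odd * p)" for k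
  proof -
    obtain p where "p \<in> polys_haupt" and p: "p93_series (3 ^ (2 * k + 1)) ((3 ^ (2 * k + 1) + 5) div 4)
        = fps_const (3 ^ (2 * k + 2)) * (g_odd * p)"
      using odd by blast
    obtain q where q: "q \<in> polys_haupt" "trisect 2 (g_odd * p) = 9 * g_even * q"
      using trisect_2_g_odd[OF \<open>p \<in> polys_haupt\<close>] by blast
    define x where "x = (3 :: nat) ^ (2 * k + 1)"
    have "3 * x = 3 ^ (2 * k + 2)" "9 * x = 3 ^ (2 * k + 3)"
      by (simp_all add: x_def eval_nat_numeral)
    \<comment> \<open>Adding 2x = 8x / 4 turns the old offset into the new one.\<close>
    moreover have "x * 2 + (x + 5) div 4 = (9 * x + 5) div 4"
      by presburger
    ultimately have "p93_series (3 ^ (2 * k + 2)) ((3 ^ (2 * k + 3) + 5) div 4)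
        = trisect 2 (fps_const (3 ^ (2 * k + 2)) * (g_odd * p))"
      unfolding p[symmetric] trisect_p93_series x_def[symmetric] by simp
    also have "\<dots> = fps_const (3 ^ (2 * k + 2) * 9) * (g_even * q)"
      unfolding trisect_const_mult q
      by (simp only: fps_numeral_fps_const mult.assoc flip: fps_const_mult)
    also have "(3::int) ^ (2 * k + 2) * 9 = 3 ^ (2 * k + 4)"
      by (simp add: power_add)
    finally show ?thesis
      using q(1) by blast
  qed
  have odd: "\<exists>p\<in>polys_haupt. p93_series (3 ^ (2 * k + 1)) ((3 ^ (2 * k + 1) + 5) div 4)
      = fps_const (3 ^ (2 * k + 2)) * (g_odd * p)" for k
  proof (induction k)
    case 0
    have "p93_series 3 2 = trisect 2 (Abs_fps p93)"
      by (rule fps_ext) (simp add: p93_series_def)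
    then show ?case
      using trisect_2_p93
      by (intro bexI[of _ 1]) (simp_all add: polys_haupt_one fps_numeral_fps_const)
  next
    case (Suc k)
    obtain p where "p \<in> polys_haupt" and p: "p93_series (3 ^ (2 * k + 2)) ((3 ^ (2 * k + 3) + 5) div 4)
        = fps_const (3 ^ (2 * k + 4)) * (g_even * p)"
      using even[OF Suc.IH] by blast
    obtain q where q: "q \<in> polys_haupt" "trisect 0 (g_even * p) = g_odd * q"
      using trisect_0_g_even[OF \<open>p \<in> polys_haupt\<close>] by blast
    have e: "2 * Suc k + 1 = 2 * k + 3" "2 * Suc k + 2 = 2 * k + 4" by simp_all
    have "(3 :: nat) * 3 ^ (2 * k + 2) = 3 ^ (2 * k + 3)"
      by (simp add: eval_nat_numeral)
    then have "p93_series (3 ^ (2 * k + 3)) ((3 ^ (2 * k + 3) + 5) div 4)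
        = trisect 0 (fps_const (3 ^ (2 * k + 4)) * (g_even * p))"
      unfolding p[symmetric] trisect_p93_series by simp
    then show ?case
      unfolding e trisect_const_mult using q by auto
  qed
  show "\<exists>p\<in>polys_haupt. p93_series (3 ^ (2 * k + 1)) ((3 ^ (2 * k + 1) + 5) div 4)
     = fps_const (3 ^ (2 * k + 2)) * (g_odd * p)"
    by (rule odd)
  show "\<exists>p\<in>polys_haupt. p93_series (3 ^ (2 * k + 2)) ((3 ^ (2 * k + 3) + 5) div 4)
     = fps_const (3 ^ (2 * k + 4)) * (g_even * p)"
    by (rule even[OF odd])
qed

lemma p93_dvd:
  assumes "p93_series m s = fps_const c * f" "fps_const d dvd trisect r f"
    and "s' = m * r + s"
  shows "c * d dvd p93 (3 * m * n + s')"
proof -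
  obtain g where g: "trisect r f = fps_const d * g" using assms(2) ..
  have "p93_series (3 * m) s' = trisect r (p93_series m s)"
    by (simp add: trisect_p93_series assms(3))
  also have "\<dots> = fps_const (c * d) * g"
    unfolding assms(1) trisect_const_mult g by (simp flip: mult.assoc)
  finally have "fps_nth (p93_series (3 * m) s') n = c * d * fps_nth g n"
    by simp
  then show ?thesis
    by (simp add: p93_series_def)
qed

theorem theorem1p3:
  fixes n \<alpha> :: nat
  assumes "\<alpha> \<ge> 1"
  shows "[p93 (3 ^ (2 * \<alpha> - 1) * n + (3 ^ (2 * \<alpha> - 1) + 5) div 4) = 0] (mod 3 ^ (2 * \<alpha>))
    \<and> [p93 (3 ^ (2 * \<alpha> + 1) * n + (7 * 3 ^ (2 * \<alpha>) + 5) div 4) = 0] (mod 3 ^ (2 * \<alpha> + 4))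
    \<and> [p93 (3 ^ (2 * \<alpha> + 1) * n + (11 * 3 ^ (2 * \<alpha>) + 5) div 4) = 0] (mod 3 ^ (2 * \<alpha> + 5))
    \<and> [p93 (3 ^ (2 * \<alpha>) * n + (5 * 3 ^ (2 * \<alpha> - 1) + 5) div 4) = 0] (mod 3 ^ (2 * \<alpha> + 1))
    \<and> [p93 (3 ^ (2 * \<alpha>) * n + (3 ^ (2 * \<alpha> + 1) + 5) div 4) = 0] (mod 3 ^ (2 * \<alpha> + 2))"
proof -
  define k where "k = \<alpha> - 1"
  define x where "x = (3 :: nat) ^ (2 * k + 1)"
  have \<alpha>: "2 * \<alpha> - 1 = 2 * k + 1" "2 * \<alpha> = 2 * k + 2"
    using assms by (simp_all add: k_def)
  have x: "3 ^ (2 * k + 2) = 3 * x" "3 ^ (2 * k + 2 + 1) = 9 * x" "3 ^ (2 * k + 3) = 9 * x"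
    by (simp_all add: x_def eval_nat_numeral)
  obtain p where p: "p \<in> polys_haupt" "p93_series x ((x + 5) div 4) = fps_const (3 ^ (2 * k + 2)) * (g_odd * p)"
    using p93_series_odd_even(1)[of k] unfolding x_def by blast
  obtain q where q: "q \<in> polys_haupt"
    "p93_series (3 * x) ((9 * x + 5) div 4) = fps_const (3 ^ (2 * k + 4)) * (g_even * q)"
    using p93_series_odd_even(2)[of k] unfolding x by blast
  have pow: "(3 :: int) ^ (2 * k + 2 + 1) = 3 ^ (2 * k + 2) * 3" "(3 :: int) ^ (2 * k + 2 + 2) = 3 ^ (2 * k + 4)"
    "(3 :: int) ^ (2 * k + 2 + 4) = 3 ^ (2 * k + 4) * 9" "(3 :: int) ^ (2 * k + 2 + 5) = 3 ^ (2 * k + 4) * 27"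
    "3 * (3 * x) = 9 * x"
    by (simp_all add: power_add)
  have "3 ^ (2 * k + 2) dvd fps_nth (p93_series x ((x + 5) div 4)) n"
    unfolding p(2) by simp
  then have "3 ^ (2 * k + 2) dvd p93 (x * n + (x + 5) div 4)"
    by (simp only: p93_series_def fps_nth_Abs_fps)
  moreover have "3 ^ (2 * k + 4) dvd fps_nth (p93_series (3 * x) ((9 * x + 5) div 4)) n"
    unfolding q(2) by simp
  then have "3 ^ (2 * k + 2 + 2) dvd p93 (3 * x * n + (9 * x + 5) div 4)"
    by (simp only: pow p93_series_def fps_nth_Abs_fps)
  \<comment> \<open>Residue 1 of the odd series: x + (x + 5) / 4 = (5x + 5) / 4.\<close>
  moreover have "3 ^ (2 * k + 2 + 1) dvd p93 (3 * x * n + (5 * x + 5) div 4)"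
    unfolding pow by (rule p93_dvd[OF p(2) trisect_1_g_odd_dvd[OF p(1)]]) presburger
  \<comment> \<open>Residues 1 and 2 of the even series add 3x and 6x to (9x + 5) / 4, giving the
    numerators 21x + 5 and 33x + 5.\<close>
  moreover have "3 ^ (2 * k + 2 + 4) dvd p93 (9 * x * n + (7 * (3 * x) + 5) div 4)"
    unfolding pow(1-4) pow(5)[symmetric]
    by (rule p93_dvd[OF q(2) trisect_g_even_dvd(1)[OF q(1)]]) presburger
  moreover have "3 ^ (2 * k + 2 + 5) dvd p93 (9 * x * n + (11 * (3 * x) + 5) div 4)"
    unfolding pow(1-4) pow(5)[symmetric]
    by (rule p93_dvd[OF q(2) trisect_g_even_dvd(2)[OF q(1)]]) presburger
  ultimately show ?thesis
    unfolding \<alpha>(1) unfolding \<alpha>(2) cong_0_iff x x_def[symmetric] by blast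
qed

end
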